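(* Let $A=\mathbb C[t^{\pm1}]$, and let $V$ be an irreducible module for $A\rtimes\mathrm{Der}A$ which is a weight module for $H$ with finite dimensional weight spaces, on which $A$ acts associatively (i.e. $t^r.(t^s.v)=t^{r+s}.v$) and $1.v=v$ for all $v\in V$. Let $\alpha\in\mathbb C$ be such that $V_\alpha=\{v\in V:d_0v=\alpha v\}\ne0$, and let $\overline V^\alpha=V/W$ be the $T'$-module defined in the context. Then: 1. $\mathbf m^2d\,\overline V^\alpha=0$. 2. Consequently $\overline V^\alpha$ is a module for the quotient Lie algebra $\mathbf m d/\mathbf m^2 d$, which is identified with the one-dimensional Lie algebra $\mathbb C=\mathfrak{gl}_1$ via the isomorphism $(t-1)f(t)d\mapsto f(1)$; as such $\overline V^\alpha$ is an irreducible module for $\mathbb C$, and $V\simeq\overline V^\alpha\otimes A$ as $A\rtimes\mathrm{Der}A$-modules, where for all $r,s\in\mathbb Z$, $v\in\overline V^\alpha$, $$d_r.(v\otimes t^s)=(s+\alpha)\,v\otimes t^{r+s}+r\,(1.v)\otimes t^{r+s},\qquad t^r.(v\otimes t^s)=v\otimes t^{r+s},$$ with $1.v$ denoting the action of $1\in\mathbb C=\mathfrak{gl}_1$ on $v$.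
   Context: Everything is over $\mathbb C$. Let $d=t\frac{d}{dt}$ and $d_r=t^rd$ for $r\in\mathbb Z$; these form a basis of $\mathrm{Der}A$, with $[d_r,d_s]=(s-r)d_{r+s}$. $A\rtimes\mathrm{Der}A$ is the Lie algebra with additional brackets $[t^r,t^s]=0$, $[d_r,t^s]=s\,t^{r+s}$. $H=\mathbb C\,t^0\oplus\mathbb C d_0$, and "weight module" means that $H$ acts diagonalizably, weight spaces being the simultaneous eigenspaces. Let $\mathbf m$ be the maximal ideal of $A$ generated by $t-1$, and write $\mathbf m^kd=\{fd:f\in\mathbf m^k\}\subset\mathrm{Der}A$. Let $I(r)=(t^r-1)d=d_r-d_0$ and $T'=\mathrm{span}\{I(r):r\in\mathbb Z\}=\mathbf m d$, a Lie subalgebra of $A\rtimes\mathrm{Der}A$. Let $W=\mathrm{span}\{t^r.v-v:v\in V_\alpha,\ r\in\mathbb Z\}$, which is a $T'$-submodule of $V$; $\overline V=V/W$ is the quotient $T'$-module, also denoted $\overline V^\alpha$. *)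

theory Defs
  imports
    "HOL-Algebra.Algebraic_Closure_Type"
    "HOL-Algebra.Ideal_Product"
    "HOL-Algebra.QuotRing"
    "HOL-Algebra.Module"
    "HOL-Library.Poly_Mapping"
begin

section \<open>Complex vector spaces as module records\<close>

abbreviation complex_field :: "complex ring"
  where "complex_field \<equiv> ring_of_type_algebra"

text \<open>
  The \<^const>\<open>monoid.mult\<close> field of a module record is used for the bracket of a Lie algebra; it plays no
  role for vector spaces that are not Lie algebras.  The \<^const>\<open>one\<close> field is never used.
\<close>

type_synonym 'a cvec = "(complex, 'a) module"

text \<open>A vector space on a whole type, with zero bracket.\<close>

definition space_of :: "(complex \<Rightarrow> 'a \<Rightarrow> 'a) \<Rightarrow> 'a::ab_group_add cvec"
  where "space_of scale =
    \<lparr>carrier = UNIV, monoid.mult = (\<lambda>_ _. 0), one = 0, zero = 0, add = (+), module.smult = scale\<rparr>"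

abbreviation (input) subspace_of :: "'a set \<Rightarrow> 'a cvec \<Rightarrow> bool"
  where "subspace_of N M \<equiv> submodule N complex_field M"

definition lspan :: "'a cvec \<Rightarrow> 'a set \<Rightarrow> 'a set"
  where "lspan M S = (\<lambda>N. subspace_of N M) hull S"

definition fin_dim :: "'a cvec \<Rightarrow> 'a set \<Rightarrow> bool"
  where "fin_dim M N \<longleftrightarrow> (\<exists>S. finite S \<and> S \<subseteq> carrier M \<and> N = lspan M S)"

text \<open>The ring part is that of \<^const>\<open>FactRing\<close>, so this also gives the quotient of a Lie algebra
  by an ideal.\<close>

definition quot :: "'a cvec \<Rightarrow> 'a set \<Rightarrow> 'a set cvec"
  where "quot M N =
    \<lparr>carrier = a_rcosets\<^bsub>M\<^esub> N, monoid.mult = rcoset_mult M N, one = N +>\<^bsub>M\<^esub> \<one>\<^bsub>M\<^esub>, zero = N,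
     add = set_add M, module.smult = (\<lambda>c C. \<Union>x\<in>C. N +>\<^bsub>M\<^esub> (c \<odot>\<^bsub>M\<^esub> x))\<rparr>"

definition linear_iso :: "'a cvec \<Rightarrow> 'b cvec \<Rightarrow> ('a \<Rightarrow> 'b) \<Rightarrow> bool"
  where "linear_iso M N h \<longleftrightarrow>
    bij_betw h (carrier M) (carrier N) \<and>
    (\<forall>x\<in>carrier M. \<forall>y\<in>carrier M. h (x \<oplus>\<^bsub>M\<^esub> y) = h x \<oplus>\<^bsub>N\<^esub> h y) \<and>
    (\<forall>c. \<forall>x\<in>carrier M. h (c \<odot>\<^bsub>M\<^esub> x) = c \<odot>\<^bsub>N\<^esub> h x)"

subsection \<open>Tensor products\<close>

definition fscale :: "complex \<Rightarrow> ('a \<Rightarrow>\<^sub>0 complex) \<Rightarrow> ('a \<Rightarrow>\<^sub>0 complex)"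
  where "fscale c = Poly_Mapping.map ((*) c)"

definition free_space :: "'a set \<Rightarrow> ('a \<Rightarrow>\<^sub>0 complex) cvec"
  where "free_space S = (space_of fscale)\<lparr>carrier := {f. Poly_Mapping.keys f \<subseteq> S}\<rparr>"

definition tensor_relations :: "'a cvec \<Rightarrow> 'b cvec \<Rightarrow> ('a \<times> 'b \<Rightarrow>\<^sub>0 complex) set"
  where "tensor_relations M N = (let e = (\<lambda>x y. Poly_Mapping.single (x, y) 1) in
    {e (x \<oplus>\<^bsub>M\<^esub> x') y - e x y - e x' y | x x' y.
       x \<in> carrier M \<and> x' \<in> carrier M \<and> y \<in> carrier N} \<union>
    {e x (y \<oplus>\<^bsub>N\<^esub> y') - e x y - e x y' | x y y'.
       x \<in> carrier M \<and> y \<in> carrier N \<and> y' \<in> carrier N} \<union>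
    {e (c \<odot>\<^bsub>M\<^esub> x) y - fscale c (e x y) | c x y. x \<in> carrier M \<and> y \<in> carrier N} \<union>
    {e x (c \<odot>\<^bsub>N\<^esub> y) - fscale c (e x y) | c x y. x \<in> carrier M \<and> y \<in> carrier N})"

definition tensor_kernel :: "'a cvec \<Rightarrow> 'b cvec \<Rightarrow> ('a \<times> 'b \<Rightarrow>\<^sub>0 complex) set"
  where "tensor_kernel M N = lspan (free_space (carrier M \<times> carrier N)) (tensor_relations M N)"

definition tensor :: "'a cvec \<Rightarrow> 'b cvec \<Rightarrow> ('a \<times> 'b \<Rightarrow>\<^sub>0 complex) set cvec"
  where "tensor M N = quot (free_space (carrier M \<times> carrier N)) (tensor_kernel M N)"

definition pure_tensor :: "'a cvec \<Rightarrow> 'b cvec \<Rightarrow> 'a \<Rightarrow> 'b \<Rightarrow> ('a \<times> 'b \<Rightarrow>\<^sub>0 complex) set"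
  where "pure_tensor M N x y =
    tensor_kernel M N +>\<^bsub>free_space (carrier M \<times> carrier N)\<^esub> Poly_Mapping.single (x, y) 1"


section \<open>Lie algebras and their modules\<close>

definition lie_algebra :: "'l cvec \<Rightarrow> bool"
  where "lie_algebra L \<longleftrightarrow> Module.module complex_field L \<and>
    (\<forall>x\<in>carrier L. \<forall>y\<in>carrier L. x \<otimes>\<^bsub>L\<^esub> y \<in> carrier L) \<and>
    (\<forall>x\<in>carrier L. \<forall>y\<in>carrier L. \<forall>z\<in>carrier L.
       (x \<oplus>\<^bsub>L\<^esub> y) \<otimes>\<^bsub>L\<^esub> z = x \<otimes>\<^bsub>L\<^esub> z \<oplus>\<^bsub>L\<^esub> y \<otimes>\<^bsub>L\<^esub> z \<and>
       z \<otimes>\<^bsub>L\<^esub> (x \<oplus>\<^bsub>L\<^esub> y) = z \<otimes>\<^bsub>L\<^esub> x \<oplus>\<^bsub>L\<^esub> z \<otimes>\<^bsub>L\<^esub> y) \<and>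
    (\<forall>c. \<forall>x\<in>carrier L. \<forall>y\<in>carrier L.
       (c \<odot>\<^bsub>L\<^esub> x) \<otimes>\<^bsub>L\<^esub> y = c \<odot>\<^bsub>L\<^esub> (x \<otimes>\<^bsub>L\<^esub> y) \<and>
       x \<otimes>\<^bsub>L\<^esub> (c \<odot>\<^bsub>L\<^esub> y) = c \<odot>\<^bsub>L\<^esub> (x \<otimes>\<^bsub>L\<^esub> y)) \<and>
    (\<forall>x\<in>carrier L. x \<otimes>\<^bsub>L\<^esub> x = \<zero>\<^bsub>L\<^esub>) \<and>
    (\<forall>x\<in>carrier L. \<forall>y\<in>carrier L. \<forall>z\<in>carrier L.
       x \<otimes>\<^bsub>L\<^esub> (y \<otimes>\<^bsub>L\<^esub> z) \<oplus>\<^bsub>L\<^esub> y \<otimes>\<^bsub>L\<^esub> (z \<otimes>\<^bsub>L\<^esub> x) \<oplus>\<^bsub>L\<^esub> z \<otimes>\<^bsub>L\<^esub> (x \<otimes>\<^bsub>L\<^esub> y) = \<zero>\<^bsub>L\<^esub>)"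

definition lie_ideal :: "'l cvec \<Rightarrow> 'l set \<Rightarrow> bool"
  where "lie_ideal L J \<longleftrightarrow> subspace_of J L \<and> (\<forall>x\<in>carrier L. \<forall>y\<in>J. x \<otimes>\<^bsub>L\<^esub> y \<in> J)"

definition lie_iso :: "'l cvec \<Rightarrow> 'k cvec \<Rightarrow> ('l \<Rightarrow> 'k) \<Rightarrow> bool"
  where "lie_iso L K \<phi> \<longleftrightarrow> lie_algebra L \<and> lie_algebra K \<and> linear_iso L K \<phi> \<and>
    (\<forall>x\<in>carrier L. \<forall>y\<in>carrier L. \<phi> (x \<otimes>\<^bsub>L\<^esub> y) = \<phi> x \<otimes>\<^bsub>K\<^esub> \<phi> y)"

definition lie_module :: "'l cvec \<Rightarrow> 'v cvec \<Rightarrow> ('l \<Rightarrow> 'v \<Rightarrow> 'v) \<Rightarrow> bool"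
  where "lie_module L M \<rho> \<longleftrightarrow> lie_algebra L \<and> Module.module complex_field M \<and>
    (\<forall>x\<in>carrier L. \<forall>v\<in>carrier M. \<rho> x v \<in> carrier M) \<and>
    (\<forall>x\<in>carrier L. \<forall>v\<in>carrier M. \<forall>w\<in>carrier M. \<rho> x (v \<oplus>\<^bsub>M\<^esub> w) = \<rho> x v \<oplus>\<^bsub>M\<^esub> \<rho> x w) \<and>
    (\<forall>c. \<forall>x\<in>carrier L. \<forall>v\<in>carrier M. \<rho> x (c \<odot>\<^bsub>M\<^esub> v) = c \<odot>\<^bsub>M\<^esub> \<rho> x v) \<and>
    (\<forall>x\<in>carrier L. \<forall>y\<in>carrier L. \<forall>v\<in>carrier M. \<rho> (x \<oplus>\<^bsub>L\<^esub> y) v = \<rho> x v \<oplus>\<^bsub>M\<^esub> \<rho> y v) \<and>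
    (\<forall>c. \<forall>x\<in>carrier L. \<forall>v\<in>carrier M. \<rho> (c \<odot>\<^bsub>L\<^esub> x) v = c \<odot>\<^bsub>M\<^esub> \<rho> x v) \<and>
    (\<forall>x\<in>carrier L. \<forall>y\<in>carrier L. \<forall>v\<in>carrier M.
       \<rho> (x \<otimes>\<^bsub>L\<^esub> y) v = \<rho> x (\<rho> y v) \<ominus>\<^bsub>M\<^esub> \<rho> y (\<rho> x v))"

definition lie_submodule :: "'l cvec \<Rightarrow> 'v cvec \<Rightarrow> ('l \<Rightarrow> 'v \<Rightarrow> 'v) \<Rightarrow> 'v set \<Rightarrow> bool"
  where "lie_submodule L M \<rho> N \<longleftrightarrow> subspace_of N M \<and> (\<forall>x\<in>carrier L. \<forall>v\<in>N. \<rho> x v \<in> N)"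

definition irreducible_lie_module :: "'l cvec \<Rightarrow> 'v cvec \<Rightarrow> ('l \<Rightarrow> 'v \<Rightarrow> 'v) \<Rightarrow> bool"
  where "irreducible_lie_module L M \<rho> \<longleftrightarrow> lie_module L M \<rho> \<and> carrier M \<noteq> {\<zero>\<^bsub>M\<^esub>} \<and>
    (\<forall>N. lie_submodule L M \<rho> N \<longrightarrow> N = {\<zero>\<^bsub>M\<^esub>} \<or> N = carrier M)"

definition lie_module_iso ::
    "'l cvec \<Rightarrow> 'v cvec \<Rightarrow> ('l \<Rightarrow> 'v \<Rightarrow> 'v) \<Rightarrow> 'w cvec \<Rightarrow> ('l \<Rightarrow> 'w \<Rightarrow> 'w) \<Rightarrow> ('v \<Rightarrow> 'w) \<Rightarrow> bool"
  where "lie_module_iso L M \<rho> N \<sigma> h \<longleftrightarrow> linear_iso M N h \<and>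
    (\<forall>x\<in>carrier L. \<forall>v\<in>carrier M. h (\<rho> x v) = \<sigma> x (h v))"

definition quot_action ::
    "'v cvec \<Rightarrow> 'v set \<Rightarrow> ('l \<Rightarrow> 'v \<Rightarrow> 'v) \<Rightarrow> 'l \<Rightarrow> 'v set \<Rightarrow> 'v set"
  where "quot_action M N \<rho> x C = (\<Union>v\<in>C. N +>\<^bsub>M\<^esub> \<rho> x v)"

text \<open>The weight \<open>\<chi>\<close> is only relevant on \<open>H\<close>; if the weight space is nonzero, then \<open>\<chi>\<close> is
  automatically linear there.\<close>

definition weight_space ::
    "'v cvec \<Rightarrow> ('l \<Rightarrow> 'v \<Rightarrow> 'v) \<Rightarrow> 'l set \<Rightarrow> ('l \<Rightarrow> complex) \<Rightarrow> 'v set"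
  where "weight_space M \<rho> H \<chi> = {v\<in>carrier M. \<forall>h\<in>H. \<rho> h v = \<chi> h \<odot>\<^bsub>M\<^esub> v}"

definition weight_module :: "'v cvec \<Rightarrow> ('l \<Rightarrow> 'v \<Rightarrow> 'v) \<Rightarrow> 'l set \<Rightarrow> bool"
  where "weight_module M \<rho> H \<longleftrightarrow> lspan M (\<Union>\<chi>. weight_space M \<rho> H \<chi>) = carrier M"

text \<open>\<open>\<complex>\<close> as the Lie algebra of \<open>1 \<times> 1\<close> matrices.\<close>

definition gl1 :: "complex cvec"
  where "gl1 = (space_of (*))\<lparr>monoid.mult := (\<lambda>x y. x * y - y * x)\<rparr>"


section \<open>Laurent polynomials and their derivations\<close>

text \<open>Multiplication of \<open>int \<Rightarrow>\<^sub>0 complex\<close> is convolution, so this is the group algebra of the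
  integers.\<close>

type_synonym laurent = "int \<Rightarrow>\<^sub>0 complex"

abbreviation T :: "int \<Rightarrow> laurent"
  where "T r \<equiv> Poly_Mapping.single r 1"

definition laurent_eval :: "laurent \<Rightarrow> complex \<Rightarrow> complex"
  where "laurent_eval f z = (\<Sum>r\<in>Poly_Mapping.keys f. Poly_Mapping.lookup f r * z powi r)"

definition Der :: "(laurent \<Rightarrow> laurent) set"
  where "Der = {D. (\<forall>f g. D (f + g) = D f + D g) \<and> (\<forall>c f. D (fscale c f) = fscale c (D f)) \<and>
    (\<forall>f g. D (f * g) = D f * g + f * D g)}"

text \<open>\<open>t d/dt\<close>\<close>

definition euler :: "laurent \<Rightarrow> laurent"
  where "euler = Poly_Mapping.mapp (\<lambda>r c. of_int r * c)"

text \<open>The semidirect product \<open>A \<rtimes> Der A\<close>; a pair \<open>(f, D)\<close> stands for \<open>f + D\<close>.\<close>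

type_synonym ader = "laurent \<times> (laurent \<Rightarrow> laurent)"

definition ADer :: "ader cvec"
  where "ADer =
    \<lparr>carrier = UNIV \<times> Der,
     monoid.mult = (\<lambda>(f, D) (g, E). (D g - E f, \<lambda>h. D (E h) - E (D h))),
     one = (0, \<lambda>_. 0), zero = (0, \<lambda>_. 0),
     add = (\<lambda>(f, D) (g, E). (f + g, \<lambda>h. D h + E h)),
     module.smult = (\<lambda>c (f, D). (fscale c f, \<lambda>h. fscale c (D h)))\<rparr>"

definition tt :: "int \<Rightarrow> ader"
  where "tt r = (T r, \<lambda>_. 0)"

text \<open>The derivation \<open>f d\<close>, where \<open>d = t d/dt\<close>.\<close>

definition vfield :: "laurent \<Rightarrow> ader"
  where "vfield f = (0, \<lambda>g. f * euler g)"

definition dd :: "int \<Rightarrow> ader"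
  where "dd r = vfield (T r)"

definition Hsub :: "ader set"
  where "Hsub = lspan ADer {tt 0, dd 0}"

definition mm :: "laurent set"
  where "mm = Idl\<^bsub>ring_of_type_algebra\<^esub> {T 1 - 1}"

definition md :: "ader cvec"
  where "md = ADer\<lparr>carrier := vfield ` mm\<rparr>"

definition m2d :: "ader set"
  where "m2d = vfield ` (mm \<cdot>\<^bsub>ring_of_type_algebra\<^esub> mm)"


section \<open>The quotient of a module by the action of \<open>A\<close>\<close>

definition d0_space :: "'v cvec \<Rightarrow> (ader \<Rightarrow> 'v \<Rightarrow> 'v) \<Rightarrow> complex \<Rightarrow> 'v set"
  where "d0_space V \<rho> \<alpha> = {v\<in>carrier V. \<rho> (dd 0) v = \<alpha> \<odot>\<^bsub>V\<^esub> v}"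

definition Wsub :: "'v cvec \<Rightarrow> (ader \<Rightarrow> 'v \<Rightarrow> 'v) \<Rightarrow> complex \<Rightarrow> 'v set"
  where "Wsub V \<rho> \<alpha> = lspan V {\<rho> (tt r) v \<ominus>\<^bsub>V\<^esub> v | r v. v \<in> d0_space V \<rho> \<alpha>}"

definition Vbar :: "'v cvec \<Rightarrow> (ader \<Rightarrow> 'v \<Rightarrow> 'v) \<Rightarrow> complex \<Rightarrow> 'v set cvec"
  where "Vbar V \<rho> \<alpha> = quot V (Wsub V \<rho> \<alpha>)"

definition Vbar_action ::
    "'v cvec \<Rightarrow> (ader \<Rightarrow> 'v \<Rightarrow> 'v) \<Rightarrow> complex \<Rightarrow> ader \<Rightarrow> 'v set \<Rightarrow> 'v set"
  where "Vbar_action V \<rho> \<alpha> = quot_action V (Wsub V \<rho> \<alpha>) \<rho>"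

section \<open>Consistency checks\<close>

lemma lookup_fscale [simp]:
  "Poly_Mapping.lookup (fscale c f) k = c * Poly_Mapping.lookup f k"
  unfolding fscale_def by (simp add: map.rep_eq when_def)

lemma lookup_euler [simp]:
  "Poly_Mapping.lookup (euler f) r = of_int r * Poly_Mapping.lookup f r"
  unfolding euler_def by (simp add: lookup_mapp when_def in_keys_iff)

lemma euler_T: "euler (T r) = fscale (of_int r) (T r)"
  by (rule poly_mapping_eqI) (simp add: lookup_single when_def)

lemma laurent_induct [case_names single add]:
  fixes f :: "'a \<Rightarrow>\<^sub>0 complex"
  assumes s: "\<And>k c. P (Poly_Mapping.single k c)" and a: "\<And>f g. P f \<Longrightarrow> P g \<Longrightarrow> P (f + g)"
  shows "P f"
proof (induction f rule: update_induct)
  case const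
  show ?case using s [of undefined 0] by simp
next
  case (update f k b)
  have "Poly_Mapping.update k b f = f + Poly_Mapping.single k b"
    using update(1) by (intro poly_mapping_eqI)
      (auto simp: lookup_update lookup_add lookup_single when_def in_keys_iff)
  then show ?case using a [OF update(3) s] by simp
qed

lemma fscale_add: "fscale c (f + g) = fscale c f + fscale c g"
  by (rule poly_mapping_eqI) (simp add: lookup_add algebra_simps)

lemma fscale_conv: "fscale c f = Poly_Mapping.single 0 c * (f :: laurent)"
proof (induction f rule: laurent_induct)
  case (single k v)
  show ?case
    by (rule poly_mapping_eqI) (simp add: lookup_single mult_single when_def)
next
  case (add f g)
  then show ?case by (simp add: fscale_add algebra_simps)
qed

lemma euler_add: "euler (f + g) = euler f + euler g"
  by (rule poly_mapping_eqI) (simp add: lookup_add algebra_simps)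

lemma euler_zero [simp]: "euler 0 = 0"
  by (rule poly_mapping_eqI) simp

lemma euler_fscale: "euler (fscale c f) = fscale c (euler f)"
  by (rule poly_mapping_eqI) simp

lemma euler_mult: "euler (f * g) = euler f * g + f * euler g"
proof (induction f rule: laurent_induct)
  case (single k v)
  show ?case
  proof (induction g rule: laurent_induct)
    case (single l w)
    have e: "euler (Poly_Mapping.single r c) = Poly_Mapping.single r (of_int r * c)" for r c
      by (rule poly_mapping_eqI) (simp add: lookup_single when_def)
    show ?case
      by (simp add: mult_single e single_add [symmetric] algebra_simps)
  next
    case (add g1 g2)
    then show ?case by (simp add: euler_add algebra_simps)
  qed
next
  case (add f1 f2)
  then show ?case by (simp add: euler_add algebra_simps)
qed

lemma vfield_in_ADer: "vfield f \<in> carrier ADer"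
  by (simp add: vfield_def ADer_def Der_def euler_add euler_mult euler_fscale)
    (simp add: fscale_conv algebra_simps)

lemma fscale_T_mult: "T r * fscale c (T s) = fscale c (T (r + s))"
  by (simp add: fscale_conv mult_single)

lemma ADer_brackets:
  "tt r \<otimes>\<^bsub>ADer\<^esub> tt s = \<zero>\<^bsub>ADer\<^esub>"
  "dd r \<otimes>\<^bsub>ADer\<^esub> tt s = of_int s \<odot>\<^bsub>ADer\<^esub> tt (r + s)"
  "dd r \<otimes>\<^bsub>ADer\<^esub> dd s = of_int (s - r) \<odot>\<^bsub>ADer\<^esub> dd (r + s)"
proof -
  show "tt r \<otimes>\<^bsub>ADer\<^esub> tt s = \<zero>\<^bsub>ADer\<^esub>"
    by (simp add: tt_def ADer_def)
  show "dd r \<otimes>\<^bsub>ADer\<^esub> tt s = of_int s \<odot>\<^bsub>ADer\<^esub> tt (r + s)"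
    by (simp add: tt_def dd_def vfield_def ADer_def euler_T fscale_T_mult)
      (simp add: fscale_conv)
  have "T r * euler (T s * euler h) - T s * euler (T r * euler h) =
      fscale (of_int (s - r)) (T (r + s) * euler h)" for h
  proof -
    have "T r * euler (T s * euler h) - T s * euler (T r * euler h) =
        (T r * euler (T s) - T s * euler (T r)) * euler h"
      by (simp add: euler_mult algebra_simps)
    also have "T r * euler (T s) - T s * euler (T r) = fscale (of_int (s - r)) (T (r + s))"
      by (simp add: euler_T fscale_T_mult add.commute)
        (rule poly_mapping_eqI, simp add: lookup_minus algebra_simps)
    finally show ?thesis by (simp add: fscale_conv algebra_simps)
  qed
  then show "dd r \<otimes>\<^bsub>ADer\<^esub> dd s = of_int (s - r) \<odot>\<^bsub>ADer\<^esub> dd (r + s)"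
    by (simp add: dd_def vfield_def ADer_def fscale_conv)
qed

lemma Der_eq_vfield: "{0} \<times> Der = range vfield"
proof
  show "range vfield \<subseteq> {0} \<times> Der"
    using vfield_in_ADer by (auto simp: ADer_def vfield_def)
  show "{0} \<times> Der \<subseteq> range vfield"
  proof
    fix x :: ader
    assume "x \<in> {0} \<times> Der"
    then obtain D where x: "x = (0, D)" and D: "D \<in> Der" by auto
    have add: "D (f + g) = D f + D g" and sc: "D (fscale c f) = fscale c (D f)"
      and mult: "D (f * g) = D f * g + f * D g" for f g c
      using D by (auto simp: Der_def)
    define u where "u = T (- 1) * D (T 1)"
    have "D 1 = 0" using mult [of 1 1] by simp
    then have inv: "D (T (- 1)) * T 1 + T (- 1) * D (T 1) = 0"
      using mult [of "T (- 1)" "T 1"] by (simp add: mult_single)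
    have TT: "T r * (T s * g) = T (r + s) * g" for r s and g :: laurent
      by (simp add: mult_single flip: mult.assoc)
    have step: "D (T (r + s)) = D (T r) * T s + T r * D (T s)" for r s
      using mult [of "T r" "T s"] by (simp add: mult_single)
    have pos: "D (T (int n)) = fscale (of_nat n) (T (int n) * u)" for n
    proof (induction n)
      case 0
      show ?case using \<open>D 1 = 0\<close> by (simp add: fscale_conv)
    next
      case (Suc n)
      have "D (T 1) = T 1 * u"
        by (simp add: u_def TT)
      then have "D (T (int n + 1)) = fscale (of_nat n) (T (int n) * u) * T 1 + T (int n) * (T 1 * u)"
        using step [of "int n" 1] Suc by simp
      also have "\<dots> = fscale (of_nat n) (T (int n + 1) * u) + T (int n + 1) * u"
        by (simp add: TT fscale_conv mult.commute [of _ "T 1"] mult.left_commute [of "T 1"] add.commute [of 1])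
      also have "\<dots> = fscale (of_nat (Suc n)) (T (int n + 1) * u)"
        by (rule poly_mapping_eqI) (simp add: lookup_add algebra_simps)
      finally show ?case by (simp add: add.commute)
    qed
    have all: "D (T r) = fscale (of_int r) (T r * u)" for r
    proof (cases "r \<ge> 0")
      case True
      then show ?thesis using pos [of "nat r"] by simp
    next
      case False
      define n where "n = nat (- r)"
      have r: "r = - int n" using False by (simp add: n_def)
      have "0 = D (T (r + int n))" using \<open>D 1 = 0\<close> by (simp add: r)
      also have "\<dots> = D (T r) * T (int n) + T r * fscale (of_nat n) (T (int n) * u)"
        by (simp only: step pos)
      finally have "0 = (D (T r) * T (int n) + T r * fscale (of_nat n) (T (int n) * u)) * T r"
        by simp
      also have "\<dots> = T r * (T (int n) * D (T r)) + fscale (of_nat n) (T r * (T r * (T (int n) * u)))"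
        by (simp add: fscale_conv algebra_simps)
      also have "\<dots> = D (T r) + fscale (of_nat n) (T r * u)"
        by (simp add: TT r)
      finally have "D (T r) = - fscale (of_nat n) (T r * u)"
        by (metis eq_neg_iff_add_eq_0)
      also have "\<dots> = fscale (of_int r) (T r * u)"
        by (rule poly_mapping_eqI) (simp add: r)
      finally show ?thesis .
    qed
    have "D f = u * euler f" for f
    proof (induction f rule: laurent_induct)
      case (single k c)
      have s: "Poly_Mapping.single k c = fscale c (T k)"
        by (rule poly_mapping_eqI) (simp add: lookup_single when_def)
      show ?case unfolding s sc all euler_fscale euler_T
        by (simp add: fscale_conv algebra_simps)
    next
      case (add f g)
      then show ?case by (simp add: \<open>\<And>f g. D (f + g) = D f + D g\<close> euler_add algebra_simps)
    qed
    then show "x \<in> range vfield"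
      by (auto simp: x vfield_def fun_eq_iff)
  qed
qed

lemma cring_complex_field: "cring complex_field"
  by (rule cring_from_type_algebra)

lemma lie_algebra_ADer: "lie_algebra ADer"
proof -
  have Der_0: "D 0 = 0" and Der_neg: "D (- f) = - D f" and Der_diff: "D (f - g) = D f - D g"
    if D: "D \<in> Der" for D f g
  proof -
    have add: "D (f + g) = D f + D g" for f g using D by (auto simp: Der_def)
    show 0: "D 0 = 0" using add [of 0 0] by simp
    show neg: "D (- f) = - D f" for f using add [of f "- f"] 0 by (simp add: eq_neg_iff_add_eq_0 add.commute)
    show "D (f - g) = D f - D g" using add [of f "- g"] neg by simp
  qed
  have fs: "fscale c (- f) = - fscale c f" "fscale c (f - g) = fscale c f - fscale c g"
    "fscale c 0 = 0" "fscale (a + b) f = fscale a f + fscale b f"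
    "fscale a (fscale b f) = fscale (a * b) f" "fscale 1 f = f"
    for a b c and f g :: laurent
    by (rule poly_mapping_eqI; simp add: lookup_minus lookup_add algebra_simps)+
  have fm: "fscale c f * g = fscale c (f * g)" "f * fscale c g = fscale c (f * g)"
    for c and f g :: laurent
    by (simp_all add: fscale_conv algebra_simps)
  have "abelian_group ADer"
  proof (rule abelian_groupI)
    fix x assume "x \<in> carrier ADer"
    then show "\<exists>y\<in>carrier ADer. y \<oplus>\<^bsub>ADer\<^esub> x = \<zero>\<^bsub>ADer\<^esub>"
      by (intro bexI [of _ "(- fst x, \<lambda>h. - snd x h)"])
        (auto simp: ADer_def Der_def fs algebra_simps split: prod.splits)
  qed (auto simp: ADer_def Der_def fs fscale_add algebra_simps)
  then have m: "Module.module complex_field ADer"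
    by (intro moduleI cring_complex_field)
      (auto simp: ADer_def Der_def fs fm fscale_add ring_of_type_algebra_def mult.commute algebra_simps)
  have cl: "(\<lambda>h. D (E h) - E (D h)) \<in> Der" if "D \<in> Der" "E \<in> Der" for D E
    using that by (auto simp: Der_def fs algebra_simps)
  show ?thesis
    unfolding lie_algebra_def
    by (intro conjI m) (auto simp: ADer_def cl Der_diff fs Der_0; auto simp: Der_def fs fscale_add algebra_simps)+
qed

end

theory Submission
  imports Defs "HOL-Computational_Algebra.Fundamental_Theorem_Algebra"
begin

text \<open>
  The operators \<open>t\<^sup>-\<^sup>r d\<^sub>r\<close> preserve the eigenspaces of \<open>d\<^sub>0\<close>; extended linearly they
  represent \<open>mm d\<close> on \<open>V\<close> by operators that commute with \<open>A\<close>.  Put \<open>L n = (t - 1)\<^bsup>n+1\<^esup> d/dt\<close>, so that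
  \<open>[L 0, L n] = n L n\<close>.  On the finite dimensional space \<open>V\<^sub>\<alpha>\<close> only finitely many eigenvalues of \<open>L 0\<close>
  occur, so \<open>L n\<close> vanishes on \<open>V\<^sub>\<alpha>\<close> for large \<open>n\<close>, and then so does the ideal it generates, which contains
  \<open>mm\<^sup>k d\<close> for some \<open>k\<close>.  An eigenvector of \<open>L 0\<close> whose eigenvalue has maximal real part is killed by all
  \<open>L n\<close> with \<open>n > 0\<close>, hence by \<open>mm\<^sup>2 d\<close>.  The vectors killed by \<open>mm\<^sup>2 d\<close> form a submodule of
  \<open>V\<close>, as do subsequently the eigenspaces of \<open>L 0\<close>; by irreducibility \<open>mm\<^sup>2 d\<close> acts by zero and \<open>L 0\<close>
  by a scalar.  Then \<open>A v\<close> is a submodule for every \<open>v\<close> in \<open>V\<^sub>\<alpha>\<close>, so \<open>V\<close> is free of rank one over \<open>A\<close>,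
  \<open>W = mm v\<close>, and \<open>V / W\<close> is a line.
\<close>

section \<open>Laurent polynomials\<close>

abbreviation ev :: "laurent \<Rightarrow> complex"
  where "ev f \<equiv> laurent_eval f 1"

abbreviation tm :: laurent
  where "tm \<equiv> T 1 - 1"

lemma fscale_single: "fscale c (Poly_Mapping.single k d) = Poly_Mapping.single k (c * d)"
  by (rule poly_mapping_eqI) (simp add: lookup_single when_def)

lemma single_conv: "Poly_Mapping.single k c = fscale c (T k)"
  by (simp add: fscale_single)

lemma fscale_simps:
  "fscale c (f * g) = fscale c f * (g :: laurent)"
  "f * fscale c g = fscale c f * (g :: laurent)"
  "fscale (a + b) f = fscale a f + fscale b (f :: laurent)"
  "fscale a (fscale b f) = fscale (a * b) (f :: laurent)"
  "fscale 1 f = (f :: laurent)" "fscale 0 f = (0 :: laurent)"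
  "fscale c (0 :: laurent) = 0"
  "fscale c (- f) = - fscale c (f :: laurent)"
  "fscale c (f - g) = fscale c f - fscale c (g :: laurent)"
  by (simp_all add: fscale_conv algebra_simps flip: mult_single)
    (simp_all add: mult_single algebra_simps single_add)

lemma ev_single [simp]: "ev (Poly_Mapping.single k c) = c"
  by (simp add: laurent_eval_def)

lemma ev_zero [simp]: "ev 0 = 0"
  by (simp add: laurent_eval_def)

lemma ev_one [simp]: "ev 1 = 1"
  using ev_single [of 0 1] by simp

lemma ev_add [simp]: "ev (f + g) = ev f + ev g"
  unfolding laurent_eval_def by (rule setsum_keys_plus_distrib) (simp_all add: algebra_simps)

lemma ev_uminus [simp]: "ev (- f) = - ev f"
  using ev_add [of f "- f"] by (simp add: eq_neg_iff_add_eq_0 add.commute)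

lemma ev_diff [simp]: "ev (f - g) = ev f - ev g"
  using ev_add [of f "- g"] by simp

lemma ev_mult [simp]: "ev (f * g) = ev f * ev g"
proof (induction f rule: laurent_induct)
  case (single k c)
  show ?case
    by (induction g rule: laurent_induct) (simp_all add: mult_single algebra_simps)
qed (simp add: algebra_simps)

lemma ev_fscale [simp]: "ev (fscale c f) = c * ev f"
  by (simp add: fscale_conv)

lemma euler_single: "euler (Poly_Mapping.single k c) = Poly_Mapping.single k (of_int k * c)"
  by (rule poly_mapping_eqI) (simp add: lookup_single when_def)

lemma euler_one [simp]: "euler 1 = 0"
  using euler_single [of 0 1] by simp

lemma euler_diff: "euler (f - g) = euler f - euler g"
  by (rule poly_mapping_eqI) (simp add: lookup_minus algebra_simps)

lemma euler_u: "euler tm = T 1"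
  by (simp add: euler_diff euler_single)

lemma T_mult [simp]: "T r * T s = T (r + s)"
  by (simp add: mult_single)

lemma T_mult_left [simp]: "T r * (T s * f) = T (r + s) * f"
  by (simp flip: mult.assoc)

text \<open>Both t and its inverse are congruent to 1 modulo t - 1, so induction upwards and
  downwards from 0 reaches every integer exponent.\<close>

lemma T_eq_one_plus: "\<exists>g. T k = 1 + tm * g"
proof (induction k rule: int_induct [where k = 0])
  case base
  show ?case by (intro exI [of _ 0]) simp
next
  case (step1 i)
  then obtain g where "T i = 1 + tm * g" by blast
  then have "T (i + 1) = (1 + tm * g) * (1 + tm)"
    by (metis T_mult add_diff_cancel_left' diff_add_cancel)
  then have "T (i + 1) = 1 + tm * (g + 1 + tm * g)"
    by (simp add: algebra_simps)
  then show ?case ..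
next
  case (step2 i)
  then obtain g where g: "T i = 1 + tm * g" by blast
  have "T (i - 1) = T i * T (- 1)" by simp
  also have "\<dots> = 1 + tm * (g * T (- 1) - T (- 1))"
    unfolding g by (simp add: algebra_simps)
  finally show ?case ..
qed

text \<open>By linearity only monomials matter, and these are constants modulo t - 1. The
  decomposition A = C 1 + \<open>mm\<close> does the work of division with remainder.\<close>

lemma laurent_decomp: "\<exists>g. f = fscale (ev f) 1 + tm * g"
proof (induction f rule: laurent_induct)
  case (single k c)
  obtain g where g: "T k = 1 + tm * g" using T_eq_one_plus by blast
  have "Poly_Mapping.single k c = fscale c 1 + tm * fscale c g"
    by (subst single_conv, subst g) (simp add: fscale_conv algebra_simps)
  then show ?case by auto
next
  case (add f g)
  then obtain f' g' where fg: "f = fscale (ev f) 1 + tm * f'" "g = fscale (ev g) 1 + tm * g'" by blast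
  have "f + g = fscale (ev f) 1 + tm * f' + (fscale (ev g) 1 + tm * g')"
    using fg by simp
  also have "\<dots> = fscale (ev (f + g)) 1 + tm * (f' + g')"
    by (simp only: ev_add fscale_simps) (simp add: algebra_simps)
  finally show ?case ..
qed

lemma ev_eq_0_iff: "ev f = 0 \<longleftrightarrow> (\<exists>g. f = tm * g)"
  using laurent_decomp [of f] by (auto simp: fscale_simps)

lemma ev_eq_0E:
  assumes "ev f = 0" obtains g where "f = tm * g"
  using assms ev_eq_0_iff by blast

section \<open>Annihilating products of linear factors\<close>

locale complex_vector_space = vector_space scale
  for scale :: "complex \<Rightarrow> 'v::ab_group_add \<Rightarrow> 'v" (infixr \<open>*s\<close> 75)
begin

text \<open>The operator (F - l_1) ... (F - l_n), kept as a list of roots with repetitions so that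
  factors can be split off one at a time.\<close>

definition root_prod :: "('v \<Rightarrow> 'v) \<Rightarrow> complex list \<Rightarrow> 'v \<Rightarrow> 'v"
  where "root_prod F = foldr (\<lambda>l w. F w - l *s w)"

lemma root_prod_simps [simp]:
  "root_prod F [] v = v"
  "root_prod F (l # ls) v = F (root_prod F ls v) - l *s root_prod F ls v"
  "root_prod F (ls @ ms) v = root_prod F ls (root_prod F ms v)"
  by (simp_all add: root_prod_def)

definition poly_act :: "('v \<Rightarrow> 'v) \<Rightarrow> complex poly \<Rightarrow> 'v \<Rightarrow> 'v"
  where "poly_act F p v = fold_coeffs (\<lambda>a w. a *s v + F w) p 0"

context
  fixes F :: "'v \<Rightarrow> 'v"
  assumes F_add: "\<And>v w. F (v + w) = F v + F w" and F_scale: "\<And>c v. F (c *s v) = c *s F v"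
begin

lemma F_0: "F 0 = 0" using F_scale [of 0 0] by simp

lemma F_diff: "F (v - w) = F v - F w"
  using F_add [of "v - w" w] by (simp add: algebra_simps)

lemma root_prod_linear:
  "root_prod F ls (v + w) = root_prod F ls v + root_prod F ls w"
  "root_prod F ls (c *s v) = c *s root_prod F ls v"
  by (induction ls) (simp_all add: F_add F_scale algebra_simps)

lemma root_prod_zero: "root_prod F ls 0 = 0"
  using root_prod_linear(2) [of ls 0 0] by simp

lemma root_prod_commute: "root_prod F ls (F v - l *s v) = F (root_prod F ls v) - l *s root_prod F ls v"
  by (induction ls) (simp_all add: F_diff F_scale, simp add: algebra_simps)

lemma root_prod_commutes: "root_prod F ls (root_prod F ms v) = root_prod F ms (root_prod F ls v)"
  by (induction ms) (simp_all add: root_prod_commute)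

text \<open>Setting aside the leading factor F - l leaves \<open>z\<close> with F z = l z. On
  \<open>z\<close> the second product acts by the scalar prod (l - n), which is nonzero because l is
  not among its roots; so z = 0 and the first list shortens.\<close>

lemma root_prod_disjoint:
  assumes "root_prod F ls v = 0" "root_prod F ms v = 0" "set ls \<inter> set ms = {}"
  shows "v = 0"
  using assms
proof (induction ls)
  case (Cons l ls)
  define z where "z = root_prod F ls v"
  have Xz: "F z = l *s z" using Cons.prems(1) by (simp add: z_def)
  have eig: "root_prod F ns z = (\<Prod>n\<leftarrow>ns. l - n) *s z" for ns
    by (induction ns) (simp_all add: F_scale Xz algebra_simps)
  have "root_prod F ms z = 0"
    using Cons.prems(2) by (simp add: z_def root_prod_commutes [of ms] root_prod_zero)
  moreover have "(\<Prod>n\<leftarrow>ms. l - n) \<noteq> 0"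
    using Cons.prems(3) by (auto simp: prod_list_zero_iff)
  ultimately have "z = 0" by (simp add: eig)
  then show ?case using Cons by (auto simp: z_def)
qed simp

section \<open>Annihilating polynomials on a finite dimensional space\<close>

lemma poly_act_0 [simp]: "poly_act F 0 v = 0"
  by (simp add: poly_act_def)

lemma poly_act_pCons: "poly_act F (pCons a p) v = a *s v + F (poly_act F p v)"
  by (cases "a = 0 \<and> p = 0") (auto simp: poly_act_def F_0 fold_coeffs_pCons_coeff_not_0_eq)

lemma poly_act_add: "poly_act F (p + q) v = poly_act F p v + poly_act F q v"
proof (induction p arbitrary: q)
  case (pCons a p)
  show ?case
  proof (cases q)
    case (pCons b r)
    show ?thesis unfolding pCons
      by (simp add: poly_act_pCons \<open>\<And>q. poly_act F (p + q) v = poly_act F p v + poly_act F q v\<close>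
          F_add scale_left_distrib ac_simps)
  qed
qed simp

lemma poly_act_smult: "poly_act F (smult c p) v = c *s poly_act F p v"
  by (induction p) (simp_all add: poly_act_pCons F_scale algebra_simps)

lemma poly_act_factor:
  "poly_act F ([:- l, 1:] * q) v = poly_act F q (F v - l *s v)"
proof -
  have "poly_act F q (F v - l *s v) = F (poly_act F q v) - l *s poly_act F q v"
    by (induction q) (simp_all add: poly_act_pCons F_add F_diff F_scale F_0, simp add: algebra_simps)
  then show ?thesis
    by (simp add: poly_act_add poly_act_smult poly_act_pCons del: smult_minus_left)
qed

text \<open>A nonconstant complex polynomial has a root. Its linear factor is applied to
  \<open>v\<close> first, so the induction on the degree has to let \<open>v\<close> vary.\<close>

lemma root_prod_of_poly:
  assumes "p \<noteq> 0" "poly_act F p v = 0"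
  shows "\<exists>ls. root_prod F ls v = 0"
  using assms
proof (induction "degree p" arbitrary: p v)
  case 0
  then obtain a where "p = [:a:]" by (metis degree_0_id)
  with 0 have "v = 0" by (simp add: poly_act_pCons F_0)
  then show ?case by (intro exI [of _ "[]"]) simp
next
  case (Suc n)
  then obtain l where "poly p l = 0"
    using alg_closed_imp_poly_has_root [of p] by auto
  then obtain q where q: "p = [:- l, 1:] * q" by (metis dvdE poly_eq_0_iff_dvd)
  with Suc have "q \<noteq> 0" by auto
  then have "degree q = n" using q Suc(2) by (simp add: degree_mult_eq del: mult_pCons_left)
  moreover have "poly_act F q (F v - l *s v) = 0"
    using Suc.prems(2) unfolding q poly_act_factor .
  ultimately obtain ls where "root_prod F ls (F v - l *s v) = 0"
    using Suc(1) \<open>q \<noteq> 0\<close> by metis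
  then show ?case by (intro exI [of _ "ls @ [l]"]) simp
qed

text \<open>Otherwise the iterates F^i v would all be linearly independent inside a finite
  dimensional space. \<open>P n\<close> collects the p(F) v with deg p < n or p = 0; it contains the
  span of the first n iterates.\<close>

lemma annihilating_poly:
  assumes S: "finite S" and E: "\<And>i. (F ^^ i) v \<in> span S"
  shows "\<exists>p. p \<noteq> 0 \<and> poly_act F p v = 0"
proof (rule ccontr)
  assume no: "\<not> ?thesis"
  define P where "P n = {poly_act F p v | p. degree p < n \<or> p = 0}" for n
  have sub: "subspace (P n)" for n
  proof (rule subspaceI)
    show "0 \<in> P n" by (force simp: P_def)
    show "x + y \<in> P n" if xy: "x \<in> P n" "y \<in> P n" for x y
    proof -
      obtain p q where pq: "x = poly_act F p v" "y = poly_act F q v"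
        "degree p < n \<or> p = 0" "degree q < n \<or> q = 0" using xy by (auto simp: P_def)
      then have "degree (p + q) < n \<or> p + q = 0" by (auto intro: degree_add_less)
      then show ?thesis using pq by (auto simp: P_def poly_act_add [symmetric])
    qed
    show "c *s x \<in> P n" if xn: "x \<in> P n" for c x
    proof -
      obtain p where p: "x = poly_act F p v" "degree p < n \<or> p = 0"
        using xn unfolding P_def by blast
      then have "degree (smult c p) < n \<or> smult c p = 0"
        by auto
      then show ?thesis using p unfolding P_def by (metis (mono_tags, lifting) mem_Collect_eq poly_act_smult)
    qed
  qed
  have mono: "poly_act F (monom 1 i) v = (F ^^ i) v" for i
    by (induction i) (simp_all add: monom_0 monom_Suc poly_act_pCons F_0)
  define B where "B n = (\<lambda>i. (F ^^ i) v) ` {..<n}" for n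
  have "B n \<subseteq> P n" for n
  proof
    fix x assume "x \<in> B n"
    then obtain i where "i < n" "x = poly_act F (monom 1 i) v" by (auto simp: B_def mono)
    moreover from this have "degree (monom (1::complex) i) < n" by (simp add: degree_monom_eq)
    ultimately show "x \<in> P n" unfolding P_def by blast
  qed
  then have span: "span (B n) \<subseteq> P n" for n
    using sub by (simp add: span_minimal)
  have new: "(F ^^ n) v \<notin> span (B n)" for n
  proof
    assume "(F ^^ n) v \<in> span (B n)"
    then obtain p where p: "(F ^^ n) v = poly_act F p v" "degree p < n \<or> p = 0"
      using span unfolding P_def by blast
    \<comment> \<open>Subtracting \<open>p\<close> from X^n leaves the leading coefficient 1, so
      this annihilating polynomial is nonzero.\<close>
    have "poly_act F (monom 1 n + smult (- 1) p) v = 0"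
      unfolding poly_act_add poly_act_smult mono p(1) by simp
    moreover have "coeff (monom 1 n + smult (- 1) p) n = 1"
      using p(2) by (auto simp: coeff_eq_0)
    ultimately show False using no by (metis coeff_0 zero_neq_one)
  qed
  have "independent (B n) \<and> card (B n) = n" for n
  proof (induction n)
    case (Suc n)
    have "B (Suc n) = insert ((F ^^ n) v) (B n)" by (auto simp: B_def lessThan_Suc)
    moreover have "(F ^^ n) v \<notin> B n" using new span_base by blast
    ultimately show ?case using Suc new by (simp add: independent_insertI B_def)
  qed (simp add: B_def independent_empty)
  moreover have "B n \<subseteq> span S" for n using E by (auto simp: B_def)
  ultimately have "Suc (card S) \<le> card S" using independent_span_bound [OF S] by metis
  then show False by simp
qed

text \<open>Each vector of \<open>S\<close> has its own annihilating list. The factors commute, so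
  the concatenated list annihilates all of \<open>S\<close>, and by linearity its span.\<close>

lemma annihilating_root_prod:
  assumes S: "finite S" and E: "\<And>v. v \<in> span S \<Longrightarrow> F v \<in> span S"
  shows "\<exists>ls. \<forall>v\<in>span S. root_prod F ls v = 0"
proof -
  have "\<exists>ls. \<forall>v\<in>R. root_prod F ls v = 0" if "finite R" "R \<subseteq> S" for R
    using that
  proof (induction R rule: finite_induct)
    case (insert v R)
    then obtain ls where ls: "\<forall>v\<in>R. root_prod F ls v = 0" by auto
    have "(F ^^ i) v \<in> span S" for i
      using insert.prems E by (induction i) (auto intro: span_base)
    then obtain ms where "root_prod F ms v = 0"
      using annihilating_poly [OF S] root_prod_of_poly by blast
    then have "\<forall>v\<in>insert v R. root_prod F (ms @ ls) v = 0"
      using ls root_prod_zero root_prod_commutes by (metis insert_iff root_prod_simps(3))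
    then show ?case ..
  qed simp
  then obtain ls where ls: "\<forall>v\<in>S. root_prod F ls v = 0" using S by blast
  have "subspace {v. root_prod F ls v = 0}"
    by (rule subspaceI) (simp_all add: root_prod_zero root_prod_linear)
  then have "span S \<subseteq> {v. root_prod F ls v = 0}" using ls by (intro span_minimal) auto
  then show ?thesis by blast
qed

text \<open>Strip factors from the head of the list until the remaining product no longer kills
  \<open>v\<close>: its value at \<open>v\<close> is killed by the factor removed last, hence is an
  eigenvector.\<close>

lemma eigenvector_of_root_prod:
  assumes "v \<noteq> 0" "root_prod F ls v = 0" "v \<in> E" "\<And>w. w \<in> E \<Longrightarrow> F w \<in> E" "subspace E"
  shows "\<exists>w\<in>E. \<exists>l. w \<noteq> 0 \<and> F w = l *s w"
  using assms(2)
proof (induction ls)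
  case (Cons l ls)
  have "root_prod F ms v \<in> E" for ms
    by (induction ms) (use assms in \<open>auto intro: subspace_diff subspace_scale\<close>)
  then show ?case using Cons by (cases "root_prod F ls v = 0") auto
qed (use assms in auto)

end

lemma eigenvalue_in_roots:
  assumes "F w = l *s w" "\<And>c v. F (c *s v) = c *s F v" "w \<noteq> 0" "root_prod F ls w = 0"
  shows "l \<in> set ls"
proof -
  have "root_prod F ns w = (\<Prod>n\<leftarrow>ns. l - n) *s w" for ns
    by (induction ns) (simp_all add: assms algebra_simps)
  then have "(\<Prod>n\<leftarrow>ls. l - n) = 0" using assms by simp
  then show ?thesis by (auto simp: prod_list_zero_iff)
qed

end

section \<open>Associative modules over the Laurent polynomials and their derivations\<close>

lemma space_of_simps [simp]:
  "carrier (space_of scale) = UNIV" "zero (space_of scale) = 0"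
  "add (space_of scale) = (+)" "module.smult (space_of scale) = scale"
  by (simp_all add: space_of_def)

lemma abelian_group_space_of: "abelian_group (space_of scale)"
  by (rule abelian_groupI) (auto simp: algebra_simps intro: exI [of _ "- x" for x])

lemma minus_space_of [simp]: "x \<ominus>\<^bsub>space_of scale\<^esub> y = x - y"
proof -
  interpret abelian_group "space_of scale" by (rule abelian_group_space_of)
  have "\<ominus>\<^bsub>space_of scale\<^esub> y = - y" by (rule minus_equality) simp_all
  then show ?thesis by (simp add: a_minus_def)
qed

lemma complex_field_simps [simp]:
  "carrier complex_field = UNIV" "zero complex_field = 0" "one complex_field = 1"
  "add complex_field = (+)" "monoid.mult complex_field = (*)"
  by (simp_all add: ring_of_type_algebra_def)

lemma ADer_simps [simp]:
  "(f, D) \<in> carrier ADer \<longleftrightarrow> D \<in> Der"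
  "(f, D) \<oplus>\<^bsub>ADer\<^esub> (g, E) = (f + g, \<lambda>h. D h + E h)"
  "(f, D) \<otimes>\<^bsub>ADer\<^esub> (g, E) = (D g - E f, \<lambda>h. D (E h) - E (D h))"
  "c \<odot>\<^bsub>ADer\<^esub> (f, D) = (fscale c f, \<lambda>h. fscale c (D h))"
  by (simp_all add: ADer_def)

lemma zero_in_Der [simp]: "(\<lambda>_. 0) \<in> Der"
  by (simp add: Der_def fscale_simps)

lemma vfield_ops:
  "vfield f \<oplus>\<^bsub>ADer\<^esub> vfield g = vfield (f + g)"
  "c \<odot>\<^bsub>ADer\<^esub> vfield f = vfield (fscale c f)"
  "vfield f \<otimes>\<^bsub>ADer\<^esub> (g, \<lambda>_. 0) = (f * euler g, \<lambda>_. 0)"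
  "vfield f \<otimes>\<^bsub>ADer\<^esub> vfield g = vfield (f * euler g - euler f * g)"
  by (simp_all add: vfield_def ADer_def fscale_conv euler_mult algebra_simps)

text \<open>Rests on the fact that every derivation of A is a multiple of t d/dt.\<close>

lemma ADer_cases:
  assumes "x \<in> carrier ADer"
  obtains f g where "x = (f, \<lambda>_. 0) \<oplus>\<^bsub>ADer\<^esub> vfield g"
proof -
  obtain f D where x: "x = (f, D)" "D \<in> Der" using assms by (cases x) auto
  then obtain g where "(0, D) = vfield g" using Der_eq_vfield by blast
  then have "x = (f, \<lambda>_. 0) \<oplus>\<^bsub>ADer\<^esub> vfield g"
    by (simp add: x vfield_def)
  then show ?thesis ..
qed

locale ader_module = complex_vector_space scale
  for scale :: "complex \<Rightarrow> 'v::ab_group_add \<Rightarrow> 'v" (infixr \<open>*s\<close> 75) +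
  fixes \<rho> :: "ader \<Rightarrow> 'v \<Rightarrow> 'v"
  assumes rep: "lie_module ADer (space_of scale) \<rho>"
    and assoc: "\<And>r s v. \<rho> (tt r) (\<rho> (tt s) v) = \<rho> (tt (r + s)) v"
    and unit: "\<And>v. \<rho> (tt 0) v = v"
begin

definition mu :: "laurent \<Rightarrow> 'v \<Rightarrow> 'v"
  where "mu f = \<rho> (f, \<lambda>_. 0)"

definition dv :: "laurent \<Rightarrow> 'v \<Rightarrow> 'v"
  where "dv f = \<rho> (vfield f)"

lemma rho_add: "x \<in> carrier ADer \<Longrightarrow> \<rho> x (v + w) = \<rho> x v + \<rho> x w"
  and rho_scale: "x \<in> carrier ADer \<Longrightarrow> \<rho> x (c *s v) = c *s \<rho> x v"
  and rho_add_left: "x \<in> carrier ADer \<Longrightarrow> y \<in> carrier ADer \<Longrightarrow> \<rho> (x \<oplus>\<^bsub>ADer\<^esub> y) v = \<rho> x v + \<rho> y v"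
  and rho_scale_left: "x \<in> carrier ADer \<Longrightarrow> \<rho> (c \<odot>\<^bsub>ADer\<^esub> x) v = c *s \<rho> x v"
  and rho_bracket: "x \<in> carrier ADer \<Longrightarrow> y \<in> carrier ADer \<Longrightarrow>
    \<rho> (x \<otimes>\<^bsub>ADer\<^esub> y) v = \<rho> x (\<rho> y v) - \<rho> y (\<rho> x v)"
  using rep by (simp_all add: lie_module_def)

lemma mu_linear [simp]:
  "mu f (v + w) = mu f v + mu f w" "mu f (c *s v) = c *s mu f v"
  "mu (f + g) v = mu f v + mu g v" "mu (fscale c f) v = c *s mu f v"
  using rho_add_left [of "(f, \<lambda>_. 0)" "(g, \<lambda>_. 0)"] rho_scale_left [of "(f, \<lambda>_. 0)" c]
  by (simp_all add: mu_def rho_add rho_scale fscale_simps)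

lemma dv_linear [simp]:
  "dv f (v + w) = dv f v + dv f w" "dv f (c *s v) = c *s dv f v"
  "dv (f + g) v = dv f v + dv g v" "dv (fscale c f) v = c *s dv f v"
  by (simp_all add: dv_def rho_add rho_scale rho_add_left rho_scale_left vfield_in_ADer flip: vfield_ops(1,2))

lemma mu_zero [simp]: "mu f 0 = 0" "mu 0 v = 0"
  using mu_linear(2) [of f 0 0] mu_linear(4) [of 0 0 v] by (simp_all add: fscale_simps)

lemma dv_zero [simp]: "dv f 0 = 0" "dv 0 v = 0"
  using dv_linear(2) [of f 0 0] dv_linear(4) [of 0 0 v] by (simp_all add: fscale_simps)

lemma mu_diff: "mu f (v - w) = mu f v - mu f w" "mu (f - g) v = mu f v - mu g v"
  using mu_linear(1) [of f "v - w" w] mu_linear(3) [of "f - g" g v] by (simp_all add: algebra_simps)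

lemma mu_one [simp]: "mu 1 v = v"
  using unit by (simp add: mu_def tt_def)

text \<open>Associativity is given for powers of t only; both sides are bilinear in \<open>f\<close>
  and \<open>g\<close>.\<close>

lemma mu_mult: "mu (f * g) v = mu f (mu g v)"
proof (induction f rule: laurent_induct)
  case (single k c)
  show ?case
  proof (induction g rule: laurent_induct)
    case (single l d)
    have "mu (T k) (mu (T l) v) = mu (T (k + l)) v"
      using assoc by (simp add: mu_def tt_def)
    then show ?case
      unfolding single_conv [of k c] single_conv [of l d]
      by (simp add: fscale_simps fscale_T_mult flip: fscale_simps(1))
  qed (simp add: algebra_simps)
qed (simp add: algebra_simps)

lemma dv_mu: "dv f (mu g v) = mu g (dv f v) + mu (f * euler g) v"
  using rho_bracket [OF vfield_in_ADer, of "(g, \<lambda>_. 0)" f v]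
  by (simp add: vfield_ops mu_def dv_def)

lemma dv_dv: "dv f (dv g v) = dv g (dv f v) + dv (f * euler g - euler f * g) v"
  using rho_bracket [OF vfield_in_ADer vfield_in_ADer, of f g v]
  by (simp add: vfield_ops dv_def)

text \<open>The linear extension of \<open>t\<^sup>r \<mapsto> t\<^sup>-\<^sup>r d\<^sub>r\<close>.  It is a representation of \<open>f d\<close> only for
  \<open>f \<in> mm\<close>: the correction terms in \<open>twist_twist\<close> vanish when \<open>f(1) = g(1) = 0\<close>.\<close>

definition twist :: "laurent \<Rightarrow> 'v \<Rightarrow> 'v"
  where "twist f v =
    (\<Sum>k\<in>Poly_Mapping.keys f. Poly_Mapping.lookup f k *s mu (T (- k)) (dv (T k) v))"

lemma twist_single: "twist (Poly_Mapping.single k c) v = c *s mu (T (- k)) (dv (T k) v)"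
  by (simp add: twist_def)

lemma twist_add_left [simp]: "twist (f + g) v = twist f v + twist g v"
  unfolding twist_def by (rule setsum_keys_plus_distrib) (simp_all add: algebra_simps)

lemma twist_linear [simp]:
  "twist f (v + w) = twist f v + twist f w" "twist f (c *s v) = c *s twist f v"
  "twist (fscale c f) v = c *s twist f v"
proof -
  show "twist f (v + w) = twist f v + twist f w" "twist f (c *s v) = c *s twist f v"
    by (induction f rule: laurent_induct) (simp_all add: twist_single algebra_simps)
  show "twist (fscale c f) v = c *s twist f v"
    by (induction f rule: laurent_induct)
      (simp_all add: twist_single fscale_single fscale_add algebra_simps)
qed

lemma twist_zero [simp]: "twist f 0 = 0" "twist 0 v = 0"
  using twist_linear(2) [of f 0 0] twist_linear(3) [of 0 0 v] by (simp_all add: fscale_simps)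

lemma twist_diff: "twist f (v - w) = twist f v - twist f w" "twist (f - g) v = twist f v - twist g v"
  using twist_linear(1) [of f "v - w" w] twist_add_left [of "f - g" g v]
  by (simp_all add: algebra_simps)

lemma twist_one: "twist 1 v = dv 1 v"
  using twist_single [of 0 1 v] by simp

lemma dv_T: "dv (T k) v = mu (T k) (twist (T k) v)"
  by (simp add: twist_single flip: mu_mult)

text \<open>Moving g past d_k produces t^-k (t^k \<open>euler g\<close>) = \<open>euler g\<close>
  whatever k is, so the corrections add up to the factor \<open>ev f\<close>. For f in
  \<open>mm\<close> this factor is 0, and \<open>mm\<close> d acts A-linearly.\<close>

lemma twist_mu: "twist f (mu g v) = mu g (twist f v) + ev f *s mu (euler g) v"
proof (induction f rule: laurent_induct)
  case (single k c)
  have "mu (T (- k)) (mu g w) = mu g (mu (T (- k)) w)" for w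
    by (simp add: mult.commute flip: mu_mult)
  moreover have "mu (T (- k)) (mu (T k * euler g) v) = mu (euler g) v"
    by (simp flip: mu_mult)
  ultimately show ?case by (simp add: twist_single dv_mu algebra_simps)
qed (simp add: algebra_simps)

text \<open>Bilinearity reduces the identity to f = t^k and g = t^l. The terms with
  \<open>ev\<close> arise when d_k differentiates the coefficient t^-l, and vice versa.\<close>

lemma twist_twist:
  "twist f (twist g v) - twist g (twist f v) =
     twist (f * euler g - euler f * g) v - ev f *s twist (euler g) v + ev g *s twist (euler f) v"
proof (induction f rule: laurent_induct)
  case (single k c)
  show ?case
  proof (induction g rule: laurent_induct)
    case (single l d)
    have *: "mu (T (- a)) (dv (T a) (mu (T (- b)) w)) =
        mu (T (- (a + b))) (dv (T a) w) - of_int b *s mu (T (- b)) w" for a b w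
    proof -
      have "mu (T (- a)) (dv (T a) (mu (T (- b)) w)) =
          mu (T (- a) * T (- b)) (dv (T a) w) + mu (T (- a) * (T a * euler (T (- b)))) w"
        by (simp only: dv_mu mu_linear mu_mult)
      moreover have "mu (euler (T (- b))) w = - (of_int b *s mu (T (- b)) w)"
        by (simp only: euler_T mu_linear) simp
      ultimately show ?thesis by (simp add: algebra_simps)
    qed
    have dd: "dv (T k) (dv (T l) v) - dv (T l) (dv (T k) v) = of_int (l - k) *s dv (T (k + l)) v"
    proof -
      have "T k * euler (T l) - euler (T k) * T l = fscale (of_int (l - k)) (T (k + l))"
        by (rule poly_mapping_eqI)
          (simp add: euler_single mult_single lookup_minus lookup_single when_def)
      then show ?thesis by (simp add: dv_dv [of "T k"])
    qed
    have tw: "twist (Poly_Mapping.single k c * euler (Poly_Mapping.single l d)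
        - euler (Poly_Mapping.single k c) * Poly_Mapping.single l d) v =
        (c * d * of_int (l - k)) *s mu (T (- (k + l))) (dv (T (k + l)) v)"
      by (simp add: euler_single mult_single twist_diff twist_single algebra_simps)
    have "twist (Poly_Mapping.single k c) (twist (Poly_Mapping.single l d) v)
        - twist (Poly_Mapping.single l d) (twist (Poly_Mapping.single k c) v) =
        (c * d) *s (mu (T (- (k + l))) (dv (T k) (dv (T l) v) - dv (T l) (dv (T k) v))
          - of_int l *s mu (T (- l)) (dv (T l) v) + of_int k *s mu (T (- k)) (dv (T k) v))"
      by (simp add: twist_single * mu_diff algebra_simps)
    then show ?case
      unfolding dd tw by (simp add: euler_single twist_single mu_diff algebra_simps)
  next
    case (add f g)
    from arg_cong2 [OF this, where f = "(+)"] show ?case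
    by (simp add: euler_add twist_diff algebra_simps)
  qed
next
  case (add f h)
  from arg_cong2 [OF this, where f = "(+)"] show ?case
    by (simp add: euler_add twist_diff algebra_simps)
qed

lemma twist_commutator:
  assumes "ev f = 0" "ev g = 0"
  shows "twist f (twist g v) = twist g (twist f v) + twist (f * euler g - euler f * g) v"
  using twist_twist [of f g v] assms by (simp add: algebra_simps)

text \<open>Since \<open>twist 1\<close> is d_0, this is \<open>twist_twist\<close> with g = 1,
  where the correction \<open>twist (euler f) v\<close> cancels the bracket. Hence the twisted
  operators preserve every eigenspace of d_0.\<close>

lemma twist_d0: "twist f (dv 1 v) = dv 1 (twist f v)"
  using twist_twist [of f 1 v] twist_diff(2) [of 0 "euler f" v] by (simp add: twist_one)

lemma dv_closed: "dv f v \<in> P"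
  if P: "subspace P" "\<And>f v. v \<in> P \<Longrightarrow> mu f v \<in> P" "\<And>f v. v \<in> P \<Longrightarrow> twist f v \<in> P" "v \<in> P"
proof (induction f rule: laurent_induct)
  case (single k c)
  have "dv (T k) v \<in> P" using P by (simp add: dv_T)
  then show ?case by (subst single_conv) (simp add: P(1) subspace_scale)
qed (simp add: P(1) subspace_add)

text \<open>By A = C 1 + \<open>mm\<close> and \<open>twist 1\<close> = d_0, stability has to be
  checked only for d_0 and for \<open>mm\<close> d.\<close>

lemma twist_closed:
  assumes P: "subspace P" "dv 1 v \<in> P" "\<And>g. twist (tm * g) v \<in> P"
  shows "twist f v \<in> P"
proof -
  obtain g where "f = fscale (ev f) 1 + tm * g" using laurent_decomp by blast
  then have "twist f v = ev f *s dv 1 v + twist (tm * g) v"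
    by (metis twist_add_left twist_linear(3) twist_one)
  then show ?thesis using P by (simp add: subspace_add subspace_scale)
qed

end

section \<open>Vector spaces and modules as records\<close>

lemma subspace_ofI:
  assumes M: "Module.module complex_field M" and N: "N \<subseteq> carrier M" "\<zero>\<^bsub>M\<^esub> \<in> N"
    and add: "\<And>x y. x \<in> N \<Longrightarrow> y \<in> N \<Longrightarrow> x \<oplus>\<^bsub>M\<^esub> y \<in> N"
    and smult: "\<And>c x. x \<in> N \<Longrightarrow> c \<odot>\<^bsub>M\<^esub> x \<in> N"
  shows "subspace_of N M"
proof -
  interpret Module.module complex_field M by fact
  show ?thesis
  proof (rule submoduleI)
    fix x assume x: "x \<in> N"
    then have "\<ominus>\<^bsub>M\<^esub> x = (\<ominus>\<^bsub>complex_field\<^esub> \<one>\<^bsub>complex_field\<^esub>) \<odot>\<^bsub>M\<^esub> x"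
      using smult_l_minus [of "\<one>\<^bsub>complex_field\<^esub>" x] smult_one [of x] N by (simp add: subset_iff)
    then show "\<ominus>\<^bsub>M\<^esub> x \<in> N" using smult [OF x] by (simp only:)
  qed (use assms in auto)
qed

context complex_vector_space
begin

lemma module_space_of: "Module.module complex_field (space_of scale)"
  by (intro Module.moduleI cring_complex_field abelian_group_space_of) (simp_all add: algebra_simps)

lemma subspace_of_iff: "subspace_of P (space_of scale) \<longleftrightarrow> subspace P"
proof
  interpret M: Module.module complex_field "space_of scale" by (rule module_space_of)
  show "subspace P" if "subspace_of P (space_of scale)"
    using M.submoduleE [OF that] subgroup.one_closed [OF submodule.axioms(1) [OF that]]
    by (intro subspaceI) auto
  show "subspace_of P (space_of scale)" if "subspace P"
    using that by (intro subspace_ofI module_space_of) (auto intro: subspace_0 subspace_add subspace_scale)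
qed

lemma lspan_space_of: "lspan (space_of scale) S = span S"
proof
  show "lspan (space_of scale) S \<subseteq> span S"
    unfolding lspan_def by (rule hull_minimal) (simp_all add: span_superset subspace_of_iff)
  show "span S \<subseteq> lspan (space_of scale) S"
    unfolding lspan_def hull_def by (auto simp: subspace_of_iff dest: span_minimal)
qed

end

section \<open>The irreducible case\<close>

lemma of_nat_fscale: "fscale (of_nat n) f = of_nat n * (f :: laurent)"
  by (simp add: fscale_conv)

lemma euler_u_power: "euler (tm ^ Suc n) = of_nat (Suc n) * tm ^ n * T 1"
proof (induction n)
  case (Suc n)
  have "euler (tm ^ Suc (Suc n)) = euler tm * tm ^ Suc n + tm * euler (tm ^ Suc n)"
    by (simp only: power_Suc [of tm "Suc n"] euler_mult)
  also have "\<dots> = T 1 * tm ^ Suc n + tm * (of_nat (Suc n) * tm ^ n * T 1)"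
    by (simp only: euler_u Suc.IH)
  also have "\<dots> = of_nat (Suc (Suc n)) * tm ^ Suc n * T 1"
    unfolding of_nat_Suc [of "Suc n"] power_Suc by (simp add: algebra_simps)
  finally show ?case .
qed (simp add: euler_u)

text \<open>\<open>witt n\<close> stands for \<open>(t - 1)\<^bsup>n+1\<^esup> d/dt\<close>.\<close>

definition witt :: "nat \<Rightarrow> laurent"
  where "witt n = T (- 1) * tm ^ Suc n"

lemma ev_witt [simp]: "ev (witt n) = 0"
  by (simp add: witt_def)

lemma T_witt: "T 1 * witt n = tm ^ Suc n"
  unfolding witt_def T_mult_left by simp

lemma witt_Suc: "witt (Suc n) = tm * witt n"
  by (simp add: witt_def mult.left_commute)

lemma euler_witt: "euler (witt n) = - witt n + of_nat (Suc n) * tm ^ n"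
proof -
  have "euler (witt n) = - T (- 1) * tm ^ Suc n + T (- 1) * (of_nat (Suc n) * tm ^ n * T 1)"
    unfolding witt_def euler_mult euler_u_power by (simp add: euler_single single_uminus)
  also have "T (- 1) * (of_nat (Suc n) * tm ^ n * T 1) = (T (- 1) * T 1) * (of_nat (Suc n) * tm ^ n)"
    by (simp only: ac_simps)
  finally show ?thesis by (simp add: witt_def)
qed

text \<open>Makes \<open>witt n\<close> an eigenvector of ad \<open>witt 0\<close> with eigenvalue
  n, so that its operator raises eigenvalues of \<open>witt 0\<close> by n.\<close>

lemma witt_bracket: "witt 0 * euler (witt n) - euler (witt 0) * witt n = of_nat n * witt n"
proof -
  have "witt 0 * tm ^ n = witt n" by (simp add: witt_def mult.assoc)
  then show ?thesis
    unfolding euler_witt by (simp add: algebra_simps)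
qed

text \<open>Apply \<open>laurent_decomp\<close> to t g and divide by t. With t^-1 spanning the
  complement of \<open>mm\<close>, multiplication by (t - 1)^(n+1) turns the first summand into a
  multiple of \<open>witt n\<close>.\<close>

lemma decomp_T_inverse: "\<exists>h. g = fscale (ev g) (T (- 1)) + tm * h"
proof -
  obtain h where h: "T 1 * g = fscale (ev g) 1 + tm * h"
    using laurent_decomp [of "T 1 * g"] by auto
  have "g = T (- 1) * (T 1 * g)" by simp
  also have "\<dots> = fscale (ev g) (T (- 1)) + tm * (T (- 1) * h)"
    unfolding h by (simp add: fscale_conv algebra_simps)
  finally show ?thesis ..
qed

lemma finite_real_bound: "finite A \<Longrightarrow> \<exists>N::nat. \<forall>x\<in>A. x < real N"
  by (meson bdd_above_def bdd_above_finite le_less_trans reals_Archimedean2)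

text \<open>The finite set \<open>B\<close> records that V_\<alpha> is finite dimensional;
  \<open>span B\<close> stands for this eigenspace, since \<open>dv 1\<close> is d_0.\<close>

locale irreducible_ader_module = ader_module scale \<rho>
  for scale :: "complex \<Rightarrow> 'v::ab_group_add \<Rightarrow> 'v" (infixr \<open>*s\<close> 75) and \<rho> +
  fixes \<alpha> :: complex and B :: "'v set"
  assumes irred: "irreducible_lie_module ADer (space_of scale) \<rho>"
    and finite_B: "finite B"
    and span_B: "span B = {v. dv 1 v = \<alpha> *s v}"
    and nontrivial: "span B \<noteq> {0}"
begin

lemma submodule_eq_UNIV:
  assumes P: "subspace P" and mu: "\<And>f v. v \<in> P \<Longrightarrow> mu f v \<in> P"
    and dv: "\<And>f v. v \<in> P \<Longrightarrow> dv f v \<in> P" and ne: "w \<in> P" "w \<noteq> 0"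
  shows "P = UNIV"
proof -
  have "\<rho> x v \<in> P" if "x \<in> carrier ADer" "v \<in> P" for x v
    using that(1)
  proof (rule ADer_cases)
    fix f g assume x: "x = (f, \<lambda>_. 0) \<oplus>\<^bsub>ADer\<^esub> vfield g"
    have "\<rho> x v = mu f v + dv g v"
      by (simp add: x rho_add_left vfield_in_ADer mu_def dv_def)
    then show ?thesis using P mu dv that by (simp add: subspace_add)
  qed
  then have "lie_submodule ADer (space_of scale) \<rho> P"
    using P by (simp add: lie_submodule_def subspace_of_iff)
  then show ?thesis using irred ne by (auto simp: irreducible_lie_module_def)
qed

text \<open>The form in which irreducibility is applied: stability under A, d_0 and the twisted
  \<open>mm\<close> d already gives stability under all of Der A.\<close>

lemma twist_submodule_eq_UNIV:
  assumes P: "subspace P" and mu: "\<And>f v. v \<in> P \<Longrightarrow> mu f v \<in> P"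
    and d0: "\<And>v. v \<in> P \<Longrightarrow> dv 1 v \<in> P" and tw: "\<And>g v. v \<in> P \<Longrightarrow> twist (tm * g) v \<in> P"
    and ne: "w \<in> P" "w \<noteq> 0"
  shows "P = UNIV"
  using dv_closed [OF P mu] twist_closed [OF P d0 tw] submodule_eq_UNIV [OF P mu _ ne] by blast

section \<open>The twisted operators on the weight space\<close>

lemma twist_span_B: "v \<in> span B \<Longrightarrow> twist f v \<in> span B"
  by (simp add: span_B flip: twist_d0)

lemma twist_witt:
  "twist (witt 0) (twist (witt n) v) = twist (witt n) (twist (witt 0) v) + of_nat n *s twist (witt n) v"
  using twist_commutator [of "witt 0" "witt n" v] by (simp add: witt_bracket flip: of_nat_fscale)

text \<open>Each factor \<open>twist (witt 0)\<close> - l passes through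
  \<open>twist (witt n)\<close> with its root raised by n.\<close>

lemma root_prod_twist_witt:
  "root_prod (twist (witt 0)) (map (\<lambda>l. l + of_nat n) ls) (twist (witt n) v) =
    twist (witt n) (root_prod (twist (witt 0)) ls v)"
  by (induction ls) (simp_all add: twist_witt twist_diff algebra_simps)

text \<open>As the twisted operators preserve \<open>span B\<close>, brackets with elements that
  kill \<open>span B\<close> kill it too. The bracket of a with (t - 1)^2 g minus that of (t - 1) a
  with (t - 1) g is 2 t a (t - 1) g: all derivatives of a and of (t - 1) g cancel.\<close>

lemma twist_vanishes_deep:
  assumes a: "ev a = 0"
    and K: "\<And>v. v \<in> span B \<Longrightarrow> twist a v = 0" "\<And>v. v \<in> span B \<Longrightarrow> twist (tm * a) v = 0"
    and v: "v \<in> span B"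
  shows "twist (T 1 * a * (tm * g)) v = 0"
proof -
  let ?b = "tm * g"
  have 1: "twist (a * euler (tm * ?b) - euler a * (tm * ?b)) v = 0"
    using twist_commutator [of a "tm * ?b" v] K(1) [OF v] K(1) [OF twist_span_B [OF v]] a by simp
  have 2: "twist (tm * a * euler ?b - euler (tm * a) * ?b) v = 0"
    using twist_commutator [of "tm * a" ?b v] K(2) [OF v] K(2) [OF twist_span_B [OF v]] a by simp
  have 3: "of_nat 2 * (T 1 * a * ?b) =
      a * euler (tm * ?b) - euler a * (tm * ?b) - (tm * a * euler ?b - euler (tm * a) * ?b)"
    unfolding euler_mult [of tm ?b] euler_mult [of tm a] euler_u by (simp add: algebra_simps)
  have "twist (of_nat 2 * (T 1 * a * ?b)) v = 0"
    unfolding 3 twist_diff(2) [of "a * _ - _"] 1 2 by simp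
  then show ?thesis by (simp only: twist_linear flip: of_nat_fscale) simp
qed

lemma exists_singular_vector:
  "\<exists>v\<in>span B. v \<noteq> 0 \<and> (\<exists>l. twist (witt 0) v = l *s v) \<and> (\<forall>g. twist (tm * tm * g) v = 0)"
proof -
  let ?F = "twist (witt 0)"
  have F: "\<And>v w. ?F (v + w) = ?F v + ?F w" "\<And>c v. ?F (c *s v) = c *s ?F v" by simp_all
  obtain ls where ls: "\<forall>v\<in>span B. root_prod ?F ls v = 0"
    using annihilating_root_prod [OF F finite_B twist_span_B] by blast
  \<comment> \<open>\<open>N\<close> is to exceed all differences of real parts of roots, so that
    raising the roots by n \<ge> N makes them disjoint from \<open>ls\<close>.\<close>
  have "finite ((\<lambda>(l, m). Re l - Re m) ` (set ls \<times> set ls))" by simp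
  then obtain N :: nat where "\<forall>x\<in>(\<lambda>(l, m). Re l - Re m) ` (set ls \<times> set ls). x < real N"
    using finite_real_bound by blast
  then have N: "Re l - Re m < real N" if "l \<in> set ls" "m \<in> set ls" for l m
    using that by force
  \<comment> \<open>The image of \<open>v\<close> is killed by the product over \<open>ls\<close>,
    as it lies in V_\<alpha>, and by the product over the raised roots; these have no root in
    common.\<close>
  have large: "twist (witt n) v = 0" if n: "n \<ge> N" and v: "v \<in> span B" for n v
  proof (rule root_prod_disjoint [OF F])
    show "root_prod ?F ls (twist (witt n) v) = 0"
      using ls twist_span_B [OF v] by blast
    show "root_prod ?F (map (\<lambda>l. l + of_nat n) ls) (twist (witt n) v) = 0"
      using ls v by (simp add: root_prod_twist_witt)
    show "set ls \<inter> set (map (\<lambda>l. l + of_nat n) ls) = {}"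
    proof -
      have "l \<noteq> m + of_nat n" if "l \<in> set ls" "m \<in> set ls" for l m
      proof
        assume "l = m + of_nat n"
        then have "Re l - Re m = real n" by simp
        then show False using N [OF that] n by linarith
      qed
      then show ?thesis by auto
    qed
  qed
  \<comment> \<open>Both \<open>witt N\<close> and \<open>witt (Suc N)\<close> = (t - 1)
    \<open>witt N\<close> act by zero. The exponent is N + 2 because t \<open>witt N\<close> = (t -
    1)^(N+1) and \<open>twist_vanishes_deep\<close> costs one more factor.\<close>
  have deep: "twist (tm ^ (N + 2) * g) v = 0" if "v \<in> span B" for v g
  proof -
    have "T 1 * witt N * (tm * g) = tm ^ (N + 2) * g"
      unfolding T_witt by (simp add: mult.assoc mult.left_commute)
    moreover have "twist (T 1 * witt N * (tm * g)) v = 0"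
      using that by (intro twist_vanishes_deep) (simp_all add: large flip: witt_Suc)
    ultimately show ?thesis by (simp only:)
  qed
  define L where "L = {l. \<exists>w\<in>span B. w \<noteq> 0 \<and> ?F w = l *s w}"
  have "L \<subseteq> set ls"
    unfolding L_def using eigenvalue_in_roots [where F = ?F] ls by fastforce
  then have "finite L" by (rule finite_subset) simp
  obtain v1 where "v1 \<in> span B" "v1 \<noteq> 0" using nontrivial span_zero by blast
  then have "L \<noteq> {}"
    using eigenvector_of_root_prod [OF F, of v1 ls "span B"] ls twist_span_B subspace_span
    unfolding L_def by blast
  then have "Max (Re ` L) \<in> Re ` L" using \<open>finite L\<close> by simp
  then obtain l where l: "l \<in> L" "Re l = Max (Re ` L)" by auto
  then have max: "Re m \<le> Re l" if "m \<in> L" for m using that \<open>finite L\<close> by simp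
  obtain v where v: "v \<in> span B" "v \<noteq> 0" "?F v = l *s v" using l(1) by (auto simp: L_def)
  have wv: "twist (witt n) v = 0" if "n > 0" for n
  proof (rule ccontr)
    assume ne: "twist (witt n) v \<noteq> 0"
    \<comment> \<open>The eigenvalue would be raised by n, beyond the maximal real part.\<close>
    have "?F (twist (witt n) v) = (l + of_nat n) *s twist (witt n) v"
      by (simp add: twist_witt v(3) algebra_simps)
    then have "l + of_nat n \<in> L" using ne twist_span_B [OF v(1)] by (auto simp: L_def)
    then show False using max that by fastforce
  qed
  \<comment> \<open>Descent of the exponent from N + 2 to 2: modulo (t - 1)^(n+1) every (t - 1)^n g
    is a multiple of \<open>witt (n - 1)\<close>, which kills \<open>v\<close> as n - 1 > 0.\<close>
  have "2 \<le> N + 2" by simp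
  then have "\<forall>g. twist (tm ^ 2 * g) v = 0"
  proof (induction rule: inc_induct)
    case (step n)
    show ?case
    proof
      fix g
      obtain h where h: "g = fscale (ev g) (T (- 1)) + tm * h" using decomp_T_inverse by blast
      obtain m where m: "n = Suc m" "m > 0" using step(1) by (cases n) auto
      have "tm ^ n * g = fscale (ev g) (witt m) + tm ^ Suc n * h"
        by (subst h) (simp add: m witt_def fscale_conv algebra_simps)
      then show "twist (tm ^ n * g) v = 0"
        using step.IH wv [OF m(2)] by simp
    qed
  qed (use deep [OF v(1)] in blast)
  then show ?thesis using v by (auto simp: power2_eq_square)
qed

text \<open>The vectors killed by \<open>mm\<close>^2 d form a nonzero submodule:
  \<open>mm\<close>^2 d is an ideal of \<open>mm\<close> d, and its operators commute with A and
  d_0.\<close>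

lemma twist_square [simp]: "twist (tm * tm * g) v = 0"
proof -
  define P where "P = {v. \<forall>g. twist (tm * tm * g) v = 0}"
  obtain w where w: "w \<in> P" "w \<noteq> 0" using exists_singular_vector by (auto simp: P_def)
  have "P = UNIV"
  proof (rule twist_submodule_eq_UNIV [OF _ _ _ _ w])
    show "subspace P" by (rule subspaceI) (simp_all add: P_def)
    show "mu f v \<in> P" if "v \<in> P" for f v
      using that by (simp add: P_def twist_mu)
    show "dv 1 v \<in> P" if "v \<in> P" for v
      using that by (simp add: P_def twist_d0)
    show "twist (tm * g) v \<in> P" if v: "v \<in> P" for g v
      unfolding P_def
    proof (intro CollectI allI)
      fix h
      have "tm * tm * h * euler (tm * g) - euler (tm * tm * h) * (tm * g) =
          tm * tm * (h * (T 1 * g + tm * euler g) - (of_nat 2 * T 1 * h + tm * euler h) * g)"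
        unfolding euler_mult euler_u by (simp add: algebra_simps)
      then show "twist (tm * tm * h) (twist (tm * g) v) = 0"
        using v twist_commutator [of "tm * tm * h" "tm * g" v] by (simp add: P_def)
    qed
  qed
  then show ?thesis by (auto simp: P_def)
qed

text \<open>\<open>witt 0\<close> commutes with \<open>mm\<close> d up to \<open>mm\<close>^2 d,
  which acts by zero, so its eigenspace is a submodule. The formula is then the expansion of f at t
  = 1 to first order, with \<open>ev (euler f)\<close> as derivative.\<close>

lemma twist_eigenvalue:
  obtains l where "\<And>f v. twist f v = ev f *s dv 1 v + (ev (euler f) * l) *s v"
proof -
  obtain w l where w: "w \<noteq> 0" "twist (witt 0) w = l *s w" using exists_singular_vector by blast
  define P where "P = {v. twist (witt 0) v = l *s v}"
  have "P = UNIV"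
  proof (rule twist_submodule_eq_UNIV)
    show "w \<in> P" "w \<noteq> 0" using w by (simp_all add: P_def)
    show "subspace P" by (rule subspaceI) (simp_all add: P_def algebra_simps)
    show "mu f v \<in> P" if "v \<in> P" for f v
      using that by (simp add: P_def twist_mu)
    show "dv 1 v \<in> P" if "v \<in> P" for v
      using that by (simp add: P_def twist_d0)
    show "twist (tm * g) v \<in> P" if v: "v \<in> P" for g v
    proof -
      have "T (- 1) * T 1 = 1" by simp
      then have 1: "T (- 1) * (T 1 * f) = f" for f :: laurent by simp
      have "witt 0 * euler (tm * g) - euler (witt 0) * (tm * g) = tm * tm * (T (- 1) * (g + euler g))"
        unfolding euler_mult [of tm g] euler_witt euler_u
        by (simp add: witt_def algebra_simps 1)
      then show ?thesis
        using v twist_commutator [of "witt 0" "tm * g" v] by (simp add: P_def)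
    qed
  qed
  then have F: "twist (witt 0) v = l *s v" for v by (auto simp: P_def)
  have "twist f v = ev f *s dv 1 v + (ev (euler f) * l) *s v" for f v
  proof -
    obtain g where g: "f = fscale (ev f) 1 + tm * g" using laurent_decomp by blast
    then have "euler f = T 1 * g + tm * euler g"
      by (metis add_0 euler_add euler_fscale euler_mult euler_one euler_u fscale_simps(7))
    then have ev: "ev (euler f) = ev g" by simp
    obtain h where h: "g = fscale (ev g) (T (- 1)) + tm * h" using decomp_T_inverse by blast
    have "tm * g = fscale (ev g) (witt 0) + tm * tm * h"
      by (subst h) (simp add: witt_def fscale_conv algebra_simps)
    then have "twist (tm * g) v = (ev g * l) *s v" by (simp add: F)
    then show ?thesis unfolding ev
      by (subst g) (simp add: twist_one del: ev_add)
  qed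
  then show ?thesis using that by blast
qed

text \<open>As \<open>dv f\<close> is expressed through d_0 and \<open>euler f\<close>, the orbit A
  \<open>v0\<close> of an eigenvector of d_0 is a submodule, hence everything.\<close>

theorem rank_one:
  obtains v0 l where "v0 \<noteq> 0" "dv 1 v0 = \<alpha> *s v0" "bij (\<lambda>a. mu a v0)"
    "\<And>f v. dv f v = mu f (dv 1 v) + l *s mu (euler f) v"
    "span B = range (\<lambda>c. c *s v0)"
proof -
  obtain l where l: "\<And>f v. twist f v = ev f *s dv 1 v + (ev (euler f) * l) *s v"
    using twist_eigenvalue by blast
  have dv: "dv f v = mu f (dv 1 v) + l *s mu (euler f) v" for f v
  proof (induction f rule: laurent_induct)
    case (single k c)
    show ?case
      by (subst (1 2 3) single_conv)
        (simp add: dv_T l euler_fscale euler_T algebra_simps)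
  qed (simp add: euler_add algebra_simps)
  obtain v0 where v0: "v0 \<in> span B" "v0 \<noteq> 0" using nontrivial span_zero by blast
  then have d0: "dv 1 v0 = \<alpha> *s v0" by (simp add: span_B)
  have d0_mu: "dv 1 (mu a v0) = mu (euler a) v0 + \<alpha> *s mu a v0" for a
    by (simp add: dv_mu d0)
  have "range (\<lambda>a. mu a v0) = UNIV"
  proof (rule submodule_eq_UNIV)
    show "subspace (range (\<lambda>a. mu a v0))"
      by (rule subspaceI) (auto simp flip: mu_linear(3,4) intro: range_eqI [of _ _ 0])
    show "v0 \<in> range (\<lambda>a. mu a v0)" by (rule range_eqI [of _ _ 1]) simp
    show "mu f v \<in> range (\<lambda>a. mu a v0)" if "v \<in> range (\<lambda>a. mu a v0)" for f v
      using that by (auto simp flip: mu_mult)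
    show "dv f v \<in> range (\<lambda>a. mu a v0)" if v: "v \<in> range (\<lambda>a. mu a v0)" for f v
    proof -
      obtain a where "v = mu a v0" using v by blast
      then have "dv f v = mu (f * (euler a + fscale \<alpha> a) + fscale l (euler f * a)) v0"
        by (simp add: dv [of f] d0_mu mu_mult)
      then show ?thesis by blast
    qed
  qed (rule v0)
  \<comment> \<open>Freeness, by induction on the number of terms: d_0 makes the annihilator of
    \<open>v0\<close> stable under \<open>euler\<close>.\<close>
  moreover have ann: "a = 0" if "mu a v0 = 0" for a
    using that
  proof (induction "card (Poly_Mapping.keys a)" arbitrary: a rule: less_induct)
    case less
    show ?case
    proof (rule ccontr)
      assume "a \<noteq> 0"
      then obtain k where k: "k \<in> Poly_Mapping.keys a"
        by (metis all_not_in_conv keys_eq_empty)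
      \<comment> \<open>The operator \<open>euler\<close> - k multiplies the coefficient at r by r -
        k, so it removes the term at k and no other.\<close>
      define b where "b = euler a - fscale (of_int k) a"
      have lb: "Poly_Mapping.lookup b r = (of_int r - of_int k) * Poly_Mapping.lookup a r" for r
        by (simp add: b_def lookup_minus algebra_simps)
      have "Poly_Mapping.keys b \<subset> Poly_Mapping.keys a"
        using k by (auto simp: in_keys_iff lb)
      then have "card (Poly_Mapping.keys b) < card (Poly_Mapping.keys a)"
        by (simp add: psubset_card_mono)
      moreover have "mu b v0 = 0"
        using d0_mu [of a] less.prems by (simp add: b_def mu_diff)
      ultimately have "b = 0" by (rule less.hyps)
      then have "Poly_Mapping.lookup a r = 0" if "r \<noteq> k" for r
        using lb [of r] that by simp
      then have "a = fscale (Poly_Mapping.lookup a k) (T k)"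
        by (intro poly_mapping_eqI) (simp add: lookup_single when_def)
      then have "Poly_Mapping.lookup a k *s mu (T k) v0 = 0"
        using less.prems by (metis mu_linear(4))
      then have "mu (T k) v0 = 0" using k by (simp add: in_keys_iff)
      then have "mu (T (- k) * T k) v0 = 0" by (simp only: mu_mult mu_zero)
      then show False using v0(2) by simp
    qed
  qed
  ultimately have bij: "bij (\<lambda>a. mu a v0)"
    unfolding bij_def inj_def by (metis mu_diff(2) eq_iff_diff_eq_0)
  have "span B = range (\<lambda>c. c *s v0)"
  proof
    show "range (\<lambda>c. c *s v0) \<subseteq> span B" using v0 by (auto intro: span_scale)
    show "span B \<subseteq> range (\<lambda>c. c *s v0)"
    proof
      fix v assume v: "v \<in> span B"
      obtain a where a: "v = mu a v0" using bij by (metis bij_pointE)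
      \<comment> \<open>In the eigenvalue equation for d_0 the terms with \<alpha> cancel; by
        freeness \<open>a\<close> must be constant.\<close>
      have "mu (euler a) v0 = 0" using v d0_mu [of a] by (simp add: span_B a)
      then have "euler a = 0" by (rule ann)
      then have "Poly_Mapping.lookup a r = 0" if "r \<noteq> 0" for r
        using that lookup_euler [of a r] by simp
      then have "a = fscale (Poly_Mapping.lookup a 0) (T 0)"
        by (intro poly_mapping_eqI) (simp add: lookup_single when_def del: single_one)
      then show "v \<in> range (\<lambda>c. c *s v0)"
        unfolding a by (metis mu_linear(4) mu_one rangeI single_one)
    qed
  qed
  then show ?thesis using that v0(2) d0 bij dv by blast
qed

end

section \<open>Linear surjections and transport of structure\<close>

text \<open>The target is a bare record: its module axioms are derived from those of the source.
  Quotients obtain their structure in this way, and representations are moved along such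
  maps.\<close>

definition linear_onto :: "'a cvec \<Rightarrow> 'b cvec \<Rightarrow> ('a \<Rightarrow> 'b) \<Rightarrow> bool"
  where "linear_onto M P p \<longleftrightarrow> carrier P = p ` carrier M \<and> p \<zero>\<^bsub>M\<^esub> = \<zero>\<^bsub>P\<^esub> \<and>
    (\<forall>x\<in>carrier M. \<forall>y\<in>carrier M. p (x \<oplus>\<^bsub>M\<^esub> y) = p x \<oplus>\<^bsub>P\<^esub> p y) \<and>
    (\<forall>c. \<forall>x\<in>carrier M. p (c \<odot>\<^bsub>M\<^esub> x) = c \<odot>\<^bsub>P\<^esub> p x)"

definition bracket_hom :: "'l cvec \<Rightarrow> 'k cvec \<Rightarrow> ('l \<Rightarrow> 'k) \<Rightarrow> bool"
  where "bracket_hom L Q q \<longleftrightarrow>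
    (\<forall>x\<in>carrier L. \<forall>y\<in>carrier L. q (x \<otimes>\<^bsub>L\<^esub> y) = q x \<otimes>\<^bsub>Q\<^esub> q y)"

lemma linear_onto_id: "linear_onto M M (\<lambda>x. x)"
  by (simp add: linear_onto_def)

lemma bracket_hom_id: "bracket_hom L L (\<lambda>x. x)"
  by (simp add: bracket_hom_def)

lemma module_closed:
  assumes "Module.module complex_field M"
  shows "x \<in> carrier M \<Longrightarrow> y \<in> carrier M \<Longrightarrow> x \<oplus>\<^bsub>M\<^esub> y \<in> carrier M"
    "x \<in> carrier M \<Longrightarrow> c \<odot>\<^bsub>M\<^esub> x \<in> carrier M" "\<zero>\<^bsub>M\<^esub> \<in> carrier M"
proof -
  interpret Module.module complex_field M by fact
  show "x \<in> carrier M \<Longrightarrow> y \<in> carrier M \<Longrightarrow> x \<oplus>\<^bsub>M\<^esub> y \<in> carrier M"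
    "x \<in> carrier M \<Longrightarrow> c \<odot>\<^bsub>M\<^esub> x \<in> carrier M" "\<zero>\<^bsub>M\<^esub> \<in> carrier M"
    by simp_all
qed

lemma module_image:
  assumes M: "Module.module complex_field M" and p: "linear_onto M P p"
  shows "Module.module complex_field P"
proof -
  interpret M: Module.module complex_field M by fact
  have im: "carrier P = p ` carrier M" and zero: "\<zero>\<^bsub>P\<^esub> = p \<zero>\<^bsub>M\<^esub>"
    and add: "\<And>x y. x \<in> carrier M \<Longrightarrow> y \<in> carrier M \<Longrightarrow> p x \<oplus>\<^bsub>P\<^esub> p y = p (x \<oplus>\<^bsub>M\<^esub> y)"
    and smult: "\<And>c x. x \<in> carrier M \<Longrightarrow> c \<odot>\<^bsub>P\<^esub> p x = p (c \<odot>\<^bsub>M\<^esub> x)"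
    using p by (simp_all add: linear_onto_def)
  have sc: "c \<odot>\<^bsub>M\<^esub> x \<in> carrier M" if "x \<in> carrier M" for c x
    using M.smult_closed [of c x] that by simp
  have "abelian_group P"
  proof (rule abelian_groupI)
    fix x assume "x \<in> carrier P"
    then obtain a where a: "a \<in> carrier M" "x = p a" by (auto simp: im)
    then have "p (\<ominus>\<^bsub>M\<^esub> a) \<oplus>\<^bsub>P\<^esub> x = \<zero>\<^bsub>P\<^esub>" by (simp add: add zero M.l_neg)
    then show "\<exists>y\<in>carrier P. y \<oplus>\<^bsub>P\<^esub> x = \<zero>\<^bsub>P\<^esub>" using a by (auto simp: im)
  qed (auto simp: im zero add M.a_ac)
  then show ?thesis
    using M.smult_l_distr M.smult_r_distr M.smult_assoc1 M.smult_one
    by (intro Module.moduleI cring_complex_field) (auto simp: im smult add sc)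
qed

lemma linear_onto_minus:
  assumes M: "Module.module complex_field M" and p: "linear_onto M P p"
    and xy: "x \<in> carrier M" "y \<in> carrier M"
  shows "p (x \<ominus>\<^bsub>M\<^esub> y) = p x \<ominus>\<^bsub>P\<^esub> p y"
proof -
  interpret M: Module.module complex_field M by fact
  interpret P: Module.module complex_field P by (rule module_image [OF M p])
  have add: "\<And>x y. x \<in> carrier M \<Longrightarrow> y \<in> carrier M \<Longrightarrow> p (x \<oplus>\<^bsub>M\<^esub> y) = p x \<oplus>\<^bsub>P\<^esub> p y"
    and im: "carrier P = p ` carrier M" and zero: "p \<zero>\<^bsub>M\<^esub> = \<zero>\<^bsub>P\<^esub>"
    using p by (simp_all add: linear_onto_def)
  have "\<ominus>\<^bsub>P\<^esub> p y = p (\<ominus>\<^bsub>M\<^esub> y)"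
  proof (rule P.minus_equality)
    show "p (\<ominus>\<^bsub>M\<^esub> y) \<oplus>\<^bsub>P\<^esub> p y = \<zero>\<^bsub>P\<^esub>"
      using xy by (simp add: M.l_neg zero flip: add)
  qed (use xy in \<open>auto simp: im\<close>)
  then show ?thesis using xy by (simp add: a_minus_def add)
qed

lemma lie_algebra_image:
  assumes L: "lie_algebra L" and q: "linear_onto L Q q" "bracket_hom L Q q"
  shows "lie_algebra Q"
proof -
  have M: "Module.module complex_field L" using L by (simp add: lie_algebra_def)
  note cl = module_closed [OF M]
  have im: "carrier Q = q ` carrier L" and zero: "\<zero>\<^bsub>Q\<^esub> = q \<zero>\<^bsub>L\<^esub>"
    and add: "\<And>x y. x \<in> carrier L \<Longrightarrow> y \<in> carrier L \<Longrightarrow> q x \<oplus>\<^bsub>Q\<^esub> q y = q (x \<oplus>\<^bsub>L\<^esub> y)"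
    and smult: "\<And>c x. x \<in> carrier L \<Longrightarrow> c \<odot>\<^bsub>Q\<^esub> q x = q (c \<odot>\<^bsub>L\<^esub> x)"
    and br: "\<And>x y. x \<in> carrier L \<Longrightarrow> y \<in> carrier L \<Longrightarrow> q x \<otimes>\<^bsub>Q\<^esub> q y = q (x \<otimes>\<^bsub>L\<^esub> y)"
    using q by (simp_all add: linear_onto_def bracket_hom_def)
  show ?thesis
    using L module_image [OF M q(1)] unfolding lie_algebra_def im
    by (simp add: zero add smult br cl)
qed

text \<open>All axioms concern values at images, so the surjections \<open>q\<close> and
  \<open>p\<close> carry them over. In each application one of the two maps is the identity.\<close>

lemma lie_module_image:
  assumes L: "lie_module L M \<rho>" and Q: "lie_algebra Q"
    and q: "linear_onto L Q q" "bracket_hom L Q q" and p: "linear_onto M P p"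
    and act: "\<And>x v. x \<in> carrier L \<Longrightarrow> v \<in> carrier M \<Longrightarrow> \<sigma> (q x) (p v) = p (\<rho> x v)"
  shows "lie_module Q P \<sigma>"
proof -
  have L_mod: "Module.module complex_field L" and M: "Module.module complex_field M"
    and br_cl: "\<And>x y. x \<in> carrier L \<Longrightarrow> y \<in> carrier L \<Longrightarrow> x \<otimes>\<^bsub>L\<^esub> y \<in> carrier L"
    using L by (simp_all add: lie_module_def lie_algebra_def)
  have imQ: "carrier Q = q ` carrier L"
    and addQ: "\<And>x y. x \<in> carrier L \<Longrightarrow> y \<in> carrier L \<Longrightarrow> q x \<oplus>\<^bsub>Q\<^esub> q y = q (x \<oplus>\<^bsub>L\<^esub> y)"
    and smultQ: "\<And>c x. x \<in> carrier L \<Longrightarrow> c \<odot>\<^bsub>Q\<^esub> q x = q (c \<odot>\<^bsub>L\<^esub> x)"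
    and br: "\<And>x y. x \<in> carrier L \<Longrightarrow> y \<in> carrier L \<Longrightarrow> q x \<otimes>\<^bsub>Q\<^esub> q y = q (x \<otimes>\<^bsub>L\<^esub> y)"
    and imP: "carrier P = p ` carrier M"
    and addP: "\<And>x y. x \<in> carrier M \<Longrightarrow> y \<in> carrier M \<Longrightarrow> p x \<oplus>\<^bsub>P\<^esub> p y = p (x \<oplus>\<^bsub>M\<^esub> y)"
    and smultP: "\<And>c x. x \<in> carrier M \<Longrightarrow> c \<odot>\<^bsub>P\<^esub> p x = p (c \<odot>\<^bsub>M\<^esub> x)"
    using q p by (simp_all add: linear_onto_def bracket_hom_def)
  have cl: "\<And>x v. x \<in> carrier L \<Longrightarrow> v \<in> carrier M \<Longrightarrow> \<rho> x v \<in> carrier M"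
    using L by (simp add: lie_module_def)
  show ?thesis
    using L Q module_image [OF M p] unfolding lie_module_def imQ imP
    by (simp add: addQ smultQ br addP smultP act cl br_cl module_closed [OF L_mod] module_closed [OF M]
        flip: linear_onto_minus [OF M p])
qed

lemma lie_algebra_restrict:
  assumes L: "lie_algebra L" and S: "subspace_of S L"
    and br: "\<And>x y. x \<in> S \<Longrightarrow> y \<in> S \<Longrightarrow> x \<otimes>\<^bsub>L\<^esub> y \<in> S"
  shows "lie_algebra (L\<lparr>carrier := S\<rparr>)"
proof -
  have M: "Module.module complex_field L" using L by (simp add: lie_algebra_def)
  have "S \<subseteq> carrier L" using Module.module.submoduleE(1) [OF M S] .
  then show ?thesis
    using L br submodule.submodule_is_module [OF S M] unfolding lie_algebra_def by (simp add: subset_iff)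
qed

lemma lie_module_restrict:
  assumes L: "lie_module L M \<rho>" and S: "lie_algebra (L\<lparr>carrier := S\<rparr>)" and sub: "S \<subseteq> carrier L"
  shows "lie_module (L\<lparr>carrier := S\<rparr>) M \<rho>"
  using L S sub unfolding lie_module_def by (simp add: subset_iff)

section \<open>Quotients\<close>

lemma lspan_subspace_of:
  assumes M: "Module.module complex_field M" and S: "S \<subseteq> carrier M"
  shows "subspace_of (lspan M S) M"
proof -
  interpret M: Module.module complex_field M by fact
  have mem: "x \<in> lspan M S \<longleftrightarrow> (\<forall>N. subspace_of N M \<and> S \<subseteq> N \<longrightarrow> x \<in> N)" for x
    by (auto simp: lspan_def hull_def)
  show ?thesis
  proof (rule M.submoduleI)
    show "lspan M S \<subseteq> carrier M"
      using M.carrier_is_submodule S by (auto simp: mem)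
    show "\<zero>\<^bsub>M\<^esub> \<in> lspan M S"
      using subgroup.one_closed [OF submodule.axioms(1)] by (fastforce simp: mem)
  qed (auto simp: mem M.submoduleE)
qed

locale subspace_quotient =
  fixes M :: "'a cvec" and N
  assumes M: "Module.module complex_field M" and N: "subspace_of N M"
begin

sublocale M: Module.module complex_field M by (rule M)

sublocale Q: abelian_subgroup N M
  by (rule abelian_subgroupI3 [OF additive_subgroup.intro [OF submodule.axioms(1) [OF N]] M.abelian_group_axioms])

abbreviation q :: "'a \<Rightarrow> 'a set" where "q x \<equiv> N +>\<^bsub>M\<^esub> x"

lemma N_carrier: "n \<in> N \<Longrightarrow> n \<in> carrier M"
  using M.submoduleE(1) [OF N] by blast

lemma mem_coset_iff: "y \<in> q x \<longleftrightarrow> (\<exists>n\<in>N. y = n \<oplus>\<^bsub>M\<^esub> x)"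
  by (auto simp: a_r_coset_def')

lemma coset_add_left: "n \<in> N \<Longrightarrow> x \<in> carrier M \<Longrightarrow> q (n \<oplus>\<^bsub>M\<^esub> x) = q x"
  using Q.a_repr_independence' [of "n \<oplus>\<^bsub>M\<^esub> x" x] mem_coset_iff by auto

lemma coset_eqD: "q x = q y \<Longrightarrow> x \<in> carrier M \<Longrightarrow> \<exists>n\<in>N. x = n \<oplus>\<^bsub>M\<^esub> y"
  using Q.a_rcos_self [of x] mem_coset_iff by auto

text \<open>Scaling in \<open>quot\<close> and the maps \<open>quot_action\<close> are unions over
  all representatives. When each representative gives the same coset, the union collapses to
  it.\<close>

lemma UN_coset:
  assumes "x \<in> carrier M" and "\<And>n. n \<in> N \<Longrightarrow> F (n \<oplus>\<^bsub>M\<^esub> x) = F x"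
  shows "(\<Union>y\<in>q x. F y) = F x"
proof -
  have "\<forall>y\<in>q x. F y = F x" using assms(2) by (auto simp: mem_coset_iff)
  then show ?thesis using Q.a_rcos_self [OF assms(1)] by blast
qed

lemma quot_simps:
  "carrier (quot M N) = q ` carrier M"
  "\<zero>\<^bsub>quot M N\<^esub> = N"
  "x \<in> carrier M \<Longrightarrow> y \<in> carrier M \<Longrightarrow> q x \<oplus>\<^bsub>quot M N\<^esub> q y = q (x \<oplus>\<^bsub>M\<^esub> y)"
  "x \<in> carrier M \<Longrightarrow> c \<odot>\<^bsub>quot M N\<^esub> q x = q (c \<odot>\<^bsub>M\<^esub> x)"
proof -
  show "carrier (quot M N) = q ` carrier M" by (auto simp: quot_def A_RCOSETS_def')
  show "\<zero>\<^bsub>quot M N\<^esub> = N" by (simp add: quot_def)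
  show "q x \<oplus>\<^bsub>quot M N\<^esub> q y = q (x \<oplus>\<^bsub>M\<^esub> y)" if "x \<in> carrier M" "y \<in> carrier M"
    using Q.a_rcos_sum [OF that] by (simp add: quot_def)
  show "c \<odot>\<^bsub>quot M N\<^esub> q x = q (c \<odot>\<^bsub>M\<^esub> x)" if x: "x \<in> carrier M"
  proof -
    have "(\<Union>y\<in>q x. q (c \<odot>\<^bsub>M\<^esub> y)) = q (c \<odot>\<^bsub>M\<^esub> x)"
    proof (rule UN_coset [OF x])
      fix n assume n: "n \<in> N"
      then have "c \<odot>\<^bsub>M\<^esub> n \<in> N" using M.submoduleE(4) [OF N, of c n] by simp
      then show "q (c \<odot>\<^bsub>M\<^esub> (n \<oplus>\<^bsub>M\<^esub> x)) = q (c \<odot>\<^bsub>M\<^esub> x)"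
        using x n M.smult_r_distr [of c n x] M.smult_closed [of c x] by (simp add: N_carrier coset_add_left)
    qed
    then show ?thesis by (simp add: quot_def)
  qed
qed

lemma coset_zero: "n \<in> N \<Longrightarrow> q n = N"
  by (rule Q.a_rcos_const)

lemma coset_linear_onto: "linear_onto M (quot M N) q"
  using coset_zero [of "\<zero>\<^bsub>M\<^esub>"] subgroup.one_closed [OF submodule.axioms(1) [OF N]]
  by (simp add: linear_onto_def quot_simps)

lemma quot_module: "Module.module complex_field (quot M N)"
  by (rule module_image [OF M coset_linear_onto])

lemma quot_action_coset:
  assumes \<rho>: "\<And>v w. v \<in> carrier M \<Longrightarrow> w \<in> carrier M \<Longrightarrow> \<rho> x (v \<oplus>\<^bsub>M\<^esub> w) = \<rho> x v \<oplus>\<^bsub>M\<^esub> \<rho> x w"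
    "\<And>v. v \<in> carrier M \<Longrightarrow> \<rho> x v \<in> carrier M" "\<And>n. n \<in> N \<Longrightarrow> \<rho> x n \<in> N"
    and v: "v \<in> carrier M"
  shows "quot_action M N \<rho> x (q v) = q (\<rho> x v)"
  unfolding quot_action_def using v by (intro UN_coset) (simp_all add: \<rho> N_carrier coset_add_left)

end

text \<open>\<open>rcoset_mult\<close> is a union over representatives of both cosets; it is
  collapsed first in the second argument, then in the first.\<close>

lemma lie_ideal_bracket_hom:
  assumes L: "lie_algebra L" and J: "lie_ideal L J"
  shows "bracket_hom L (quot L J) (a_r_coset L J)"
proof -
  interpret subspace_quotient L J
    using L J by (intro subspace_quotient.intro) (simp_all add: lie_algebra_def lie_ideal_def)
  have add: "(x \<oplus>\<^bsub>L\<^esub> y) \<otimes>\<^bsub>L\<^esub> z = x \<otimes>\<^bsub>L\<^esub> z \<oplus>\<^bsub>L\<^esub> y \<otimes>\<^bsub>L\<^esub> z"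
    "z \<otimes>\<^bsub>L\<^esub> (x \<oplus>\<^bsub>L\<^esub> y) = z \<otimes>\<^bsub>L\<^esub> x \<oplus>\<^bsub>L\<^esub> z \<otimes>\<^bsub>L\<^esub> y"
    if "x \<in> carrier L" "y \<in> carrier L" "z \<in> carrier L" for x y z
    using L that by (simp_all add: lie_algebra_def)
  have cl: "x \<otimes>\<^bsub>L\<^esub> y \<in> carrier L" if "x \<in> carrier L" "y \<in> carrier L" for x y
    using L that by (simp add: lie_algebra_def)
  have alt: "x \<otimes>\<^bsub>L\<^esub> x = \<zero>\<^bsub>L\<^esub>" if "x \<in> carrier L" for x
    using L that by (simp add: lie_algebra_def)
  have J2: "x \<otimes>\<^bsub>L\<^esub> n \<in> J" if "x \<in> carrier L" "n \<in> J" for x n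
    using J that by (simp add: lie_ideal_def)
  \<comment> \<open>\<open>lie_ideal\<close> speaks of brackets with \<open>J\<close> on the right.
    The other side follows by antisymmetry, from expanding [x + n, x + n] = 0.\<close>
  have J1: "n \<otimes>\<^bsub>L\<^esub> x \<in> J" if x: "x \<in> carrier L" and n: "n \<in> J" for x n
  proof -
    note [simp] = N_carrier [OF n] x cl
    have "\<zero>\<^bsub>L\<^esub> = (x \<oplus>\<^bsub>L\<^esub> n) \<otimes>\<^bsub>L\<^esub> (x \<oplus>\<^bsub>L\<^esub> n)" by (simp add: alt)
    also have "\<dots> = x \<otimes>\<^bsub>L\<^esub> (x \<oplus>\<^bsub>L\<^esub> n) \<oplus>\<^bsub>L\<^esub> n \<otimes>\<^bsub>L\<^esub> (x \<oplus>\<^bsub>L\<^esub> n)"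
      by (rule add(1)) simp_all
    also have "\<dots> = n \<otimes>\<^bsub>L\<^esub> x \<oplus>\<^bsub>L\<^esub> x \<otimes>\<^bsub>L\<^esub> n"
      by (simp add: add(2) alt M.a_comm)
    finally have "n \<otimes>\<^bsub>L\<^esub> x \<oplus>\<^bsub>L\<^esub> x \<otimes>\<^bsub>L\<^esub> n = \<zero>\<^bsub>L\<^esub>" ..
    then have "n \<otimes>\<^bsub>L\<^esub> x = \<ominus>\<^bsub>L\<^esub> (x \<otimes>\<^bsub>L\<^esub> n)" by (simp add: M.minus_equality)
    then show ?thesis using J2 [OF x n] M.submoduleE(3) [OF N] by simp
  qed
  have "rcoset_mult L J (q x) (q y) = q (x \<otimes>\<^bsub>L\<^esub> y)" if xy: "x \<in> carrier L" "y \<in> carrier L" for x y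
  proof -
    have "(\<Union>b\<in>q y. q (a \<otimes>\<^bsub>L\<^esub> b)) = q (a \<otimes>\<^bsub>L\<^esub> y)" if "a \<in> carrier L" for a
      using that xy by (intro UN_coset) (simp_all add: add N_carrier J2 coset_add_left cl)
    moreover have "q x \<subseteq> carrier L" using xy by (auto simp: mem_coset_iff N_carrier)
    ultimately have "rcoset_mult L J (q x) (q y) = (\<Union>a\<in>q x. q (a \<otimes>\<^bsub>L\<^esub> y))"
      unfolding rcoset_mult_def by (intro SUP_cong) auto
    also have "\<dots> = q (x \<otimes>\<^bsub>L\<^esub> y)"
      using xy by (intro UN_coset) (simp_all add: add N_carrier J1 coset_add_left cl)
    finally show ?thesis .
  qed
  then show ?thesis by (simp add: bracket_hom_def quot_def)
qed

lemma lie_algebra_quot: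
  assumes L: "lie_algebra L" and J: "lie_ideal L J"
  shows "lie_algebra (quot L J)"
proof -
  interpret subspace_quotient L J
    using L J by (intro subspace_quotient.intro) (simp_all add: lie_algebra_def lie_ideal_def)
  show ?thesis
    by (rule lie_algebra_image [OF L coset_linear_onto lie_ideal_bracket_hom [OF L J]])
qed

section \<open>The Lie algebra \<open>\<complex>\<close> as a quotient\<close>

lemma gl1_simps [simp]:
  "carrier gl1 = UNIV" "zero gl1 = 0" "add gl1 = (+)" "module.smult gl1 = (*)"
  "monoid.mult gl1 = (\<lambda>x y. x * y - y * x)"
  by (simp_all add: gl1_def)

lemma lie_algebra_gl1: "lie_algebra gl1"
proof -
  have "abelian_group gl1"
    by (rule abelian_groupI) (auto simp: algebra_simps intro: exI [of _ "- x" for x])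
  then have "Module.module complex_field gl1"
    by (intro Module.moduleI cring_complex_field) (simp_all add: algebra_simps)
  then show ?thesis by (simp add: lie_algebra_def)
qed

lemma cring_laurent: "cring (ring_of_type_algebra :: laurent ring)"
  by (rule cring_from_type_algebra)

lemma mm_eq: "mm = range ((*) tm)"
  and mm_mm_eq: "mm \<cdot>\<^bsub>ring_of_type_algebra\<^esub> mm = range ((*) (tm * tm))"
proof -
  interpret cring "ring_of_type_algebra :: laurent ring" by (rule cring_laurent)
  have P: "PIdl\<^bsub>ring_of_type_algebra\<^esub> f = range ((*) f)" for f :: laurent
    by (auto simp: cgenideal_def ring_of_type_algebra_def mult.commute)
  have m: "mm = PIdl\<^bsub>ring_of_type_algebra\<^esub> tm"
    unfolding mm_def by (rule cgenideal_eq_genideal [symmetric]) (simp add: ring_of_type_algebra_def)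
  then show "mm = range ((*) tm)" by (simp add: P)
  have sub: "range ((*) (tm * tm)) \<subseteq> mm \<cdot>\<^bsub>ring_of_type_algebra\<^esub> mm"
  proof
    fix x assume "x \<in> range ((*) (tm * tm))"
    then obtain g where "x = (tm * 1) * (tm * g)" by (auto simp: mult.assoc)
    then have "x = (tm * 1) \<otimes>\<^bsub>ring_of_type_algebra\<^esub> (tm * g)"
      by (simp only: ring_of_type_algebra_def monoid.simps)
    then show "x \<in> mm \<cdot>\<^bsub>ring_of_type_algebra\<^esub> mm"
      by (metis ideal_prod.prod \<open>mm = range ((*) tm)\<close> rangeI)
  qed
  have "x \<in> range ((*) (tm * tm))" if "x \<in> mm \<cdot>\<^bsub>ring_of_type_algebra\<^esub> mm" for x
    using that
  proof induction
    case (prod i j)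
    then obtain a b where "i = tm * a" "j = tm * b" using \<open>mm = range ((*) tm)\<close> by blast
    then have "i \<otimes>\<^bsub>ring_of_type_algebra\<^esub> j = tm * tm * (a * b)"
      by (simp add: ring_of_type_algebra_def ac_simps)
    then show ?case by blast
  next
    case (sum s1 s2)
    then obtain a b where "s1 = tm * tm * a" "s2 = tm * tm * b" by auto
    then have "s1 \<oplus>\<^bsub>ring_of_type_algebra\<^esub> s2 = tm * tm * (a + b)"
      by (simp add: ring_of_type_algebra_def distrib_left)
    then show ?case by blast
  qed
  then show "mm \<cdot>\<^bsub>ring_of_type_algebra\<^esub> mm = range ((*) (tm * tm))" using sub by blast
qed

lemma module_ADer: "Module.module complex_field ADer"
  using lie_algebra_ADer by (simp add: lie_algebra_def)

lemma zero_ADer: "\<zero>\<^bsub>ADer\<^esub> = vfield 0"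
  by (simp add: ADer_def vfield_def)

lemma subspace_of_vfield_ideal: "subspace_of (vfield ` range ((*) f)) ADer"
proof (rule subspace_ofI [OF module_ADer])
  show "\<zero>\<^bsub>ADer\<^esub> \<in> vfield ` range ((*) f)"
    unfolding zero_ADer by (metis imageI mult_zero_right rangeI)
  show "x \<oplus>\<^bsub>ADer\<^esub> y \<in> vfield ` range ((*) f)"
    if xy: "x \<in> vfield ` range ((*) f)" "y \<in> vfield ` range ((*) f)" for x y
  proof -
    obtain g h where "x = vfield (f * g)" "y = vfield (f * h)" using xy by blast
    then have "x \<oplus>\<^bsub>ADer\<^esub> y = vfield (f * (g + h))" by (simp add: vfield_ops distrib_left)
    then show ?thesis by blast
  qed
  show "c \<odot>\<^bsub>ADer\<^esub> x \<in> vfield ` range ((*) f)" if x: "x \<in> vfield ` range ((*) f)" for c x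
  proof -
    obtain g where "x = vfield (f * g)" using x by blast
    then have "c \<odot>\<^bsub>ADer\<^esub> x = vfield (f * fscale c g)" by (simp add: vfield_ops fscale_simps)
    then show ?thesis by blast
  qed
qed (auto simp: vfield_in_ADer)

lemma md_simps [simp]:
  "carrier md = vfield ` range ((*) tm)" "zero md = zero ADer" "add md = add ADer"
  "monoid.mult md = monoid.mult ADer" "module.smult md = module.smult ADer"
  by (simp_all add: md_def mm_eq)

lemma vfield_in_md: "vfield (tm * f) \<in> carrier md"
  unfolding md_simps by blast

lemma m2d_eq: "m2d = vfield ` range ((*) (tm * tm))"
  by (simp add: m2d_def mm_mm_eq)

lemma lie_algebra_md: "lie_algebra md"
  unfolding md_def mm_eq
proof (rule lie_algebra_restrict [OF lie_algebra_ADer subspace_of_vfield_ideal])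
  fix x y assume "x \<in> vfield ` range ((*) tm)" "y \<in> vfield ` range ((*) tm)"
  then obtain f g where "x = vfield (tm * f)" "y = vfield (tm * g)" by auto
  then have "x \<otimes>\<^bsub>ADer\<^esub> y = vfield (tm * (f * euler (tm * g) - euler (tm * f) * g))"
    by (simp add: vfield_ops algebra_simps)
  then show "x \<otimes>\<^bsub>ADer\<^esub> y \<in> vfield ` range ((*) tm)" by blast
qed

lemma lie_ideal_m2d: "lie_ideal md m2d"
  unfolding lie_ideal_def
proof
  interpret Module.module complex_field md using lie_algebra_md by (simp add: lie_algebra_def)
  have "m2d \<subseteq> carrier md" by (auto simp: m2d_eq mult.assoc)
  moreover have "Module.module complex_field (md\<lparr>carrier := m2d\<rparr>)"
    using submodule.submodule_is_module [OF subspace_of_vfield_ideal module_ADer]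
    by (simp add: m2d_eq md_def)
  ultimately show "subspace_of m2d md" by (rule module_incl_imp_submodule)
  show "\<forall>x\<in>carrier md. \<forall>y\<in>m2d. x \<otimes>\<^bsub>md\<^esub> y \<in> m2d"
  proof (intro ballI)
    fix x y assume "x \<in> carrier md" "y \<in> m2d"
    then obtain f g where xy: "x = vfield (tm * f)" "y = vfield (tm * tm * g)" by (auto simp: m2d_eq)
    have "tm * f * euler (tm * tm * g) - euler (tm * f) * (tm * tm * g) =
        tm * tm * (f * (2 * T 1 * g + tm * euler g) - (T 1 * f + tm * euler f) * g)"
      unfolding euler_mult euler_u by (simp add: algebra_simps)
    then show "x \<otimes>\<^bsub>md\<^esub> y \<in> m2d" unfolding xy md_simps vfield_ops m2d_eq by blast
  qed
qed

text \<open>The value \<open>f(1)\<close> of \<open>(t - 1) f d\<close>, written so that it is manifestly well defined.\<close>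

definition residue_at_one :: "ader \<Rightarrow> complex"
  where "residue_at_one x = ev (euler (snd x (T 1)))"

text \<open>Applied to t the field gives (t - 1) f t; after \<open>euler\<close> only the term that
  differentiates t - 1 survives at t = 1.\<close>

lemma residue_at_one_vfield [simp]: "residue_at_one (vfield (tm * f)) = ev f"
  by (simp add: residue_at_one_def vfield_def euler_mult euler_u euler_single)

interpretation md_quot: subspace_quotient md m2d
  using lie_algebra_md lie_ideal_m2d
  by (intro subspace_quotient.intro) (simp_all add: lie_algebra_def lie_ideal_def)

text \<open>The residue is constant on the cosets, so the choice of the representative is harmless.\<close>

definition quot_residue :: "ader set \<Rightarrow> complex"
  where "quot_residue C = residue_at_one (SOME x. x \<in> C)"

lemma quot_residue_coset [simp]: "quot_residue (m2d +>\<^bsub>md\<^esub> vfield (tm * f)) = ev f"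
proof -
  let ?C = "m2d +>\<^bsub>md\<^esub> vfield (tm * f)"
  have "vfield (tm * f) \<in> ?C" by (rule md_quot.Q.a_rcos_self) auto
  then have "(SOME x. x \<in> ?C) \<in> ?C" by (rule someI)
  then obtain g where "(SOME x. x \<in> ?C) = vfield (tm * tm * g) \<oplus>\<^bsub>md\<^esub> vfield (tm * f)"
    unfolding md_quot.mem_coset_iff by (auto simp: m2d_eq)
  also have "\<dots> = vfield (tm * (tm * g + f))"
    by (simp add: vfield_ops algebra_simps)
  finally show ?thesis unfolding quot_residue_def by simp
qed

lemma quot_residue_iso: "lie_iso (quot md m2d) gl1 quot_residue"
  unfolding lie_iso_def linear_iso_def
proof (intro conjI)
  have C: "\<exists>f. C = m2d +>\<^bsub>md\<^esub> vfield (tm * f)" if "C \<in> carrier (quot md m2d)" for C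
    using that by (auto simp: md_quot.quot_simps)
  \<comment> \<open>If f and g agree at 1, then f - g is a multiple of t - 1, and (t - 1) (f - g)
    lies in \<open>mm\<close>^2.\<close>
  have inj: "m2d +>\<^bsub>md\<^esub> vfield (tm * f) = m2d +>\<^bsub>md\<^esub> vfield (tm * g)" if ev: "ev f = ev g" for f g
  proof -
    obtain h where h: "f - g = tm * h" using ev_eq_0E [of "f - g"] ev by auto
    then have "f = tm * h + g" by (metis diff_add_cancel)
    then have "vfield (tm * f) = vfield (tm * tm * h) \<oplus>\<^bsub>md\<^esub> vfield (tm * g)"
      by (simp add: vfield_ops distrib_left mult.assoc)
    then show ?thesis by (simp only:) (rule md_quot.coset_add_left, auto simp: m2d_eq)
  qed
  show "bij_betw quot_residue (carrier (quot md m2d)) (carrier gl1)"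
  proof (rule bij_betwI')
    fix C D assume "C \<in> carrier (quot md m2d)" "D \<in> carrier (quot md m2d)"
    then obtain f g where CD: "C = m2d +>\<^bsub>md\<^esub> vfield (tm * f)" "D = m2d +>\<^bsub>md\<^esub> vfield (tm * g)"
      by (meson C)
    have "ev f = ev g" if "C = D"
      using that quot_residue_coset unfolding CD by metis
    then show "(quot_residue C = quot_residue D) = (C = D)"
      using inj [of f g] unfolding CD quot_residue_coset by blast
  next
    fix z :: complex
    have "quot_residue (m2d +>\<^bsub>md\<^esub> vfield (tm * fscale z 1)) = z"
      by (simp only: quot_residue_coset) simp
    moreover have "m2d +>\<^bsub>md\<^esub> vfield (tm * fscale z 1) \<in> carrier (quot md m2d)"
      unfolding md_quot.quot_simps by (intro imageI vfield_in_md)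
    ultimately show "\<exists>C\<in>carrier (quot md m2d). z = quot_residue C" by metis
  qed simp
  show "lie_algebra (quot md m2d)" by (rule lie_algebra_quot [OF lie_algebra_md lie_ideal_m2d])
  show "lie_algebra gl1" by (rule lie_algebra_gl1)
  show "\<forall>C\<in>carrier (quot md m2d). \<forall>D\<in>carrier (quot md m2d).
      quot_residue (C \<oplus>\<^bsub>quot md m2d\<^esub> D) = quot_residue C \<oplus>\<^bsub>gl1\<^esub> quot_residue D"
  proof (intro ballI)
    fix C D assume "C \<in> carrier (quot md m2d)" "D \<in> carrier (quot md m2d)"
    then obtain f g where CD: "C = m2d +>\<^bsub>md\<^esub> vfield (tm * f)" "D = m2d +>\<^bsub>md\<^esub> vfield (tm * g)"
      by (meson C)
    have "C \<oplus>\<^bsub>quot md m2d\<^esub> D = m2d +>\<^bsub>md\<^esub> vfield (tm * (f + g))"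
      unfolding CD by (subst md_quot.quot_simps) (auto simp: vfield_ops distrib_left)
    then show "quot_residue (C \<oplus>\<^bsub>quot md m2d\<^esub> D) = quot_residue C \<oplus>\<^bsub>gl1\<^esub> quot_residue D"
      unfolding CD by (simp only: quot_residue_coset) simp
  qed
  show "\<forall>c. \<forall>C\<in>carrier (quot md m2d).
      quot_residue (c \<odot>\<^bsub>quot md m2d\<^esub> C) = c \<odot>\<^bsub>gl1\<^esub> quot_residue C"
  proof (intro allI ballI)
    fix c C assume "C \<in> carrier (quot md m2d)"
    then obtain f where CD: "C = m2d +>\<^bsub>md\<^esub> vfield (tm * f)" using C by metis
    have "c \<odot>\<^bsub>quot md m2d\<^esub> C = m2d +>\<^bsub>md\<^esub> vfield (tm * fscale c f)"
      unfolding CD by (subst md_quot.quot_simps) (auto simp: vfield_ops fscale_simps)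
    then show "quot_residue (c \<odot>\<^bsub>quot md m2d\<^esub> C) = c \<odot>\<^bsub>gl1\<^esub> quot_residue C"
      unfolding CD by (simp only: quot_residue_coset) simp
  qed
  show "\<forall>C\<in>carrier (quot md m2d). \<forall>D\<in>carrier (quot md m2d).
      quot_residue (C \<otimes>\<^bsub>quot md m2d\<^esub> D) = quot_residue C \<otimes>\<^bsub>gl1\<^esub> quot_residue D"
  proof (intro ballI)
    fix C D assume "C \<in> carrier (quot md m2d)" "D \<in> carrier (quot md m2d)"
    then obtain f g where CD: "C = m2d +>\<^bsub>md\<^esub> vfield (tm * f)" "D = m2d +>\<^bsub>md\<^esub> vfield (tm * g)"
      by (meson C)
    have "C \<otimes>\<^bsub>quot md m2d\<^esub> D = m2d +>\<^bsub>md\<^esub> (vfield (tm * f) \<otimes>\<^bsub>md\<^esub> vfield (tm * g))"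
      using lie_ideal_bracket_hom [OF lie_algebra_md lie_ideal_m2d] unfolding CD
      by (simp add: bracket_hom_def)
    \<comment> \<open>The terms differentiating t - 1 cancel, so the bracket lies in
      \<open>mm\<close>^2 d. Its residue 0 agrees with the bracket of the commutative algebra
      \<open>gl1\<close>.\<close>
    also have "vfield (tm * f) \<otimes>\<^bsub>md\<^esub> vfield (tm * g) = vfield (tm * (tm * (f * euler g - euler f * g)))"
      unfolding md_simps vfield_ops euler_mult euler_u by (simp add: algebra_simps)
    finally show "quot_residue (C \<otimes>\<^bsub>quot md m2d\<^esub> D) = quot_residue C \<otimes>\<^bsub>gl1\<^esub> quot_residue D"
      unfolding CD by (simp only: quot_residue_coset) simp
  qed
qed

section \<open>Free vector spaces\<close>

lemma vector_space_fscale: "vector_space fscale"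
  by unfold_locales (auto intro!: poly_mapping_eqI simp: lookup_add algebra_simps)

lemma module_free_space: "Module.module complex_field (free_space S)"
proof -
  interpret complex_vector_space "fscale :: complex \<Rightarrow> ('a \<Rightarrow>\<^sub>0 complex) \<Rightarrow> _"
    by (intro complex_vector_space.intro vector_space_fscale)
  have "subspace {f. Poly_Mapping.keys f \<subseteq> S}"
  proof (rule subspaceI)
    fix f g :: "'a \<Rightarrow>\<^sub>0 complex" and c
    assume f: "f \<in> {f. Poly_Mapping.keys f \<subseteq> S}"
    then show "fscale c f \<in> {f. Poly_Mapping.keys f \<subseteq> S}"
      by (auto simp: in_keys_iff subset_iff)
    assume "g \<in> {f. Poly_Mapping.keys f \<subseteq> S}"
    with f show "f + g \<in> {f. Poly_Mapping.keys f \<subseteq> S}"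
      using Poly_Mapping.keys_add [of f g] by auto
  qed simp
  then have sub: "subspace_of {f. Poly_Mapping.keys f \<subseteq> S} (space_of fscale)"
    by (simp add: subspace_of_iff)
  show ?thesis
    using submodule.submodule_is_module [OF sub module_space_of] by (simp add: free_space_def)
qed

lemma free_space_simps [simp]:
  "carrier (free_space S) = {f. Poly_Mapping.keys f \<subseteq> S}" "zero (free_space S) = 0"
  "add (free_space S) = (+)" "module.smult (free_space S) = fscale"
  by (simp_all add: free_space_def)

section \<open>Modules of rank one\<close>

text \<open>What irreducibility has yielded: V = A \<open>v0\<close> with A acting freely, and f d
  is determined by d_0 and the scalar \<open>l\<close>.\<close>

locale rank_one_module = ader_module scale \<rho>
  for scale :: "complex \<Rightarrow> 'v::ab_group_add \<Rightarrow> 'v" (infixr \<open>*s\<close> 75) and \<rho> +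
  fixes \<alpha> l :: complex and v0 :: 'v
  assumes d0_v0: "dv 1 v0 = \<alpha> *s v0"
    and bij: "bij (\<lambda>a. mu a v0)"
    and dv_eq: "\<And>f v. dv f v = mu f (dv 1 v) + l *s mu (euler f) v"
    and d0_space_eq: "d0_space (space_of scale) \<rho> \<alpha> = range (\<lambda>c. c *s v0)"
begin

abbreviation "V \<equiv> space_of scale"
abbreviation "W \<equiv> Wsub V \<rho> \<alpha>"
abbreviation "U \<equiv> Vbar V \<rho> \<alpha>"

lemma v_cases: obtains a where "v = mu a v0"
  using bij by (metis bij_pointE)

lemma mu_inj: "mu a v0 = mu b v0 \<longleftrightarrow> a = b"
  using bij unfolding bij_def inj_def by blast

text \<open>In the coordinate a of a \<open>v0\<close> this is a module of tensor densities: with a'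
  = \<open>euler a\<close>, the field f d sends a to f (a' + \<alpha> a) + l f' a.\<close>

lemma dv_mu_v0: "dv f (mu a v0) = mu (f * (euler a + fscale \<alpha> a) + fscale l (euler f * a)) v0"
proof -
  have "dv 1 (mu a v0) = mu (euler a + fscale \<alpha> a) v0"
    by (simp add: dv_mu d0_v0 algebra_simps)
  then show ?thesis by (simp only: dv_eq [of f] mu_mult mu_linear)
qed

text \<open>The generators of \<open>W\<close> are the c (t^r - 1) \<open>v0\<close>, and every a -
  a(1) is a combination of the t^r - 1.\<close>

lemma W_eq: "W = {mu a v0 | a. ev a = 0}"
proof -
  have W: "W = span {\<rho> (tt r) v - v | r v. v \<in> range (\<lambda>c. c *s v0)}"
    by (simp add: Wsub_def lspan_space_of d0_space_eq)
  have gen: "\<rho> (tt r) (c *s v0) - c *s v0 = mu (fscale c (T r - 1)) v0" for r c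
    by (simp add: tt_def mu_diff scale_right_diff_distrib flip: mu_def)
  have "subspace {mu a v0 | a. ev a = 0}"
  proof (rule subspaceI)
    show "0 \<in> {mu a v0 | a. ev a = 0}" by (auto intro: exI [of _ 0])
    show "x + y \<in> {mu a v0 | a. ev a = 0}"
      if "x \<in> {mu a v0 | a. ev a = 0}" "y \<in> {mu a v0 | a. ev a = 0}" for x y
    proof -
      obtain a b where "x = mu a v0" "ev a = 0" "y = mu b v0" "ev b = 0" using \<open>x \<in> _\<close> \<open>y \<in> _\<close> by blast
      then have "x + y = mu (a + b) v0" "ev (a + b) = 0" by simp_all
      then show ?thesis by blast
    qed
    show "c *s x \<in> {mu a v0 | a. ev a = 0}" if "x \<in> {mu a v0 | a. ev a = 0}" for c x
    proof -
      obtain a where "x = mu a v0" "ev a = 0" using \<open>x \<in> _\<close> by blast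
      then have "c *s x = mu (fscale c a) v0" "ev (fscale c a) = 0" by simp_all
      then show ?thesis by blast
    qed
  qed
  then have 1: "W \<subseteq> {mu a v0 | a. ev a = 0}"
    unfolding W
  proof (rule span_minimal [rotated], intro subsetI)
    fix x assume "x \<in> {\<rho> (tt r) v - v | r v. v \<in> range (\<lambda>c. c *s v0)}"
    then obtain r c where "x = mu (fscale c (T r - 1)) v0" using gen by blast
    moreover have "ev (fscale c (T r - 1)) = 0" by simp
    ultimately show "x \<in> {mu a v0 | a. ev a = 0}" by blast
  qed
  have "mu a v0 - ev a *s v0 \<in> W" for a
  proof (induction a rule: laurent_induct)
    case (single k c)
    have "mu (Poly_Mapping.single k c) v0 - ev (Poly_Mapping.single k c) *s v0 = \<rho> (tt k) (c *s v0) - c *s v0"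
      unfolding gen by (subst single_conv) (simp add: mu_diff scale_right_diff_distrib)
    then show ?case unfolding W by (auto intro!: span_base)
  next
    case (add f g)
    have "mu (f + g) v0 - ev (f + g) *s v0 = (mu f v0 - ev f *s v0) + (mu g v0 - ev g *s v0)"
      by (simp add: algebra_simps)
    then show ?case using add unfolding W by (simp only: span_add)
  qed
  then have 2: "mu a v0 \<in> W" if "ev a = 0" for a
    using that by (metis diff_zero scale_zero_left)
  show ?thesis using 1 2 by blast
qed

lemma subspace_W: "subspace_of W V"
  by (simp add: subspace_of_iff Wsub_def lspan_space_of)

sublocale VW: subspace_quotient V W
  by (intro subspace_quotient.intro module_space_of subspace_W)

text \<open>The class of \<open>v0\<close> spans V/W, so \<open>line\<close> identifies V/W with the
  complex numbers.\<close>

definition line :: "complex \<Rightarrow> 'v set"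
  where "line z = W +>\<^bsub>V\<^esub> (z *s v0)"

lemma coset_eq_line: "W +>\<^bsub>V\<^esub> (mu a v0) = line (ev a)"
proof -
  have "mu (a - fscale (ev a) 1) v0 \<in> W" unfolding W_eq by force
  then have "W +>\<^bsub>V\<^esub> (mu (a - fscale (ev a) 1) v0 \<oplus>\<^bsub>V\<^esub> (ev a *s v0)) = line (ev a)"
    unfolding line_def by (rule VW.coset_add_left) simp
  then show ?thesis by (simp add: mu_diff)
qed

lemma line_inj: "line z = line w \<longleftrightarrow> z = w"
proof
  assume "line z = line w"
  then obtain n where "n \<in> W" "z *s v0 = n + w *s v0"
    using VW.coset_eqD [of "z *s v0" "w *s v0"] by (auto simp: line_def)
  then obtain a where "ev a = 0" "mu (fscale z 1) v0 = mu (a + fscale w 1) v0"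
    by (auto simp: W_eq)
  then have "fscale z 1 = a + fscale w 1" "ev a = 0" by (simp_all only: mu_inj)
  then show "z = w" by (metis add_0 ev_add ev_fscale ev_one mult.right_neutral)
qed simp

lemma U_simps:
  "carrier U = range line" "\<zero>\<^bsub>U\<^esub> = line 0"
  "line z \<oplus>\<^bsub>U\<^esub> line w = line (z + w)" "c \<odot>\<^bsub>U\<^esub> line z = line (c * z)"
proof -
  show "\<zero>\<^bsub>U\<^esub> = line 0"
    using VW.coset_zero [of 0] subspace_W by (simp add: Vbar_def VW.quot_simps line_def subspace_of_iff subspace_0)
  show "line z \<oplus>\<^bsub>U\<^esub> line w = line (z + w)" "c \<odot>\<^bsub>U\<^esub> line z = line (c * z)"
    by (simp_all add: Vbar_def line_def VW.quot_simps scale_left_distrib)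
  have "W +>\<^bsub>V\<^esub> v \<in> range line" for v
    by (rule v_cases [of v]) (simp add: coset_eq_line)
  then show "carrier U = range line"
    by (auto simp: Vbar_def VW.quot_simps line_def)
qed

lemma U_cases:
  assumes "x \<in> carrier U" obtains z where "x = line z"
  using assms by (auto simp: U_simps)

lemma module_U: "Module.module complex_field U"
  unfolding Vbar_def by (rule VW.quot_module)

lemma dv_tm: "dv (tm * f) (mu a v0) = mu (tm * f * (euler a + fscale \<alpha> a)
    + fscale l ((T 1 * f + tm * euler f) * a)) v0"
  unfolding dv_mu_v0 by (simp only: euler_mult euler_u)

text \<open>The action on cosets is well defined because \<open>W\<close> = \<open>mm\<close>
  \<open>v0\<close> is stable. At t = 1 the formula \<open>dv_tm\<close> keeps only l f(1) a(1); all
  other terms contain t - 1.\<close>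

lemma act_line:
  "Vbar_action V \<rho> \<alpha> (vfield (tm * f)) (W +>\<^bsub>V\<^esub> v) = W +>\<^bsub>V\<^esub> dv (tm * f) v"
  "Vbar_action V \<rho> \<alpha> (vfield (tm * f)) (line z) = line (ev f * l * z)"
proof -
  show *: "Vbar_action V \<rho> \<alpha> (vfield (tm * f)) (W +>\<^bsub>V\<^esub> v) = W +>\<^bsub>V\<^esub> dv (tm * f) v" for v
    unfolding Vbar_action_def dv_def
  proof (rule VW.quot_action_coset)
    fix n assume "n \<in> W"
    then obtain a where a: "n = mu a v0" "ev a = 0" by (auto simp: W_eq)
    have "\<rho> (vfield (tm * f)) n = dv (tm * f) n" by (simp only: dv_def)
    moreover have "ev (tm * f * (euler a + fscale \<alpha> a) + fscale l ((T 1 * f + tm * euler f) * a)) = 0"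
      using a(2) by simp
    then have "dv (tm * f) n \<in> W" unfolding a dv_tm W_eq by blast
    ultimately show "\<rho> (vfield (tm * f)) n \<in> W" by simp
  qed (simp_all add: rho_add vfield_in_ADer)
  show "Vbar_action V \<rho> \<alpha> (vfield (tm * f)) (line z) = line (ev f * l * z)"
  proof -
    have "line z = W +>\<^bsub>V\<^esub> mu (fscale z 1) v0" by (simp only: coset_eq_line ev_fscale) simp
    then have "Vbar_action V \<rho> \<alpha> (vfield (tm * f)) (line z) = W +>\<^bsub>V\<^esub> dv (tm * f) (mu (fscale z 1) v0)"
      by (simp only: *)
    also have "\<dots> = line (ev f * l * z)" by (simp only: dv_tm coset_eq_line) (simp add: ac_simps)
    finally show ?thesis .
  qed
qed

section \<open>V/W as a module for \<open>md\<close>, its quotient and \<open>gl1\<close>\<close>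

lemma lie_module_U: "lie_module md U (Vbar_action V \<rho> \<alpha>)"
proof (rule lie_module_image)
  show "lie_module md V \<rho>"
    unfolding md_def
    by (rule lie_module_restrict [OF rep]) (use lie_algebra_md vfield_in_ADer in \<open>auto simp: md_def\<close>)
  show "linear_onto V U (a_r_coset V W)"
    unfolding Vbar_def by (rule VW.coset_linear_onto)
  show "Vbar_action V \<rho> \<alpha> x (W +>\<^bsub>V\<^esub> v) = W +>\<^bsub>V\<^esub> \<rho> x v" if "x \<in> carrier md" for x v
  proof -
    obtain f where "x = vfield (tm * f)" using \<open>x \<in> _\<close> unfolding md_simps by blast
    then show ?thesis by (simp only: act_line(1) dv_def)
  qed
qed (rule lie_algebra_md linear_onto_id bracket_hom_id)+

text \<open>Since (t - 1) f d acts on V/W by the scalar l f(1), the residue z = f(1) has to act by z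
  l.\<close>

definition gl1_act :: "complex \<Rightarrow> 'v set \<Rightarrow> 'v set"
  where "gl1_act z x = (z * l) \<odot>\<^bsub>U\<^esub> x"

lemma gl1_act_line: "gl1_act z (line w) = line (z * l * w)"
  by (simp add: gl1_act_def U_simps)

lemma gl1_act_quot_residue:
  assumes "x \<in> carrier md" "y \<in> carrier U"
  shows "gl1_act (quot_residue (m2d +>\<^bsub>md\<^esub> x)) y = Vbar_action V \<rho> \<alpha> x y"
proof -
  obtain f z where "x = vfield (tm * f)" "y = line z"
    using assms U_cases unfolding md_simps by blast
  then show ?thesis by (simp only: quot_residue_coset gl1_act_line act_line)
qed

lemma lie_module_quot: "lie_module (quot md m2d) U (\<lambda>C. gl1_act (quot_residue C))"
proof (rule lie_module_image [OF lie_module_U])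
  show "linear_onto md (quot md m2d) (a_r_coset md m2d)" by (rule md_quot.coset_linear_onto)
qed (rule lie_algebra_quot lie_ideal_bracket_hom lie_algebra_md lie_ideal_m2d linear_onto_id
    gl1_act_quot_residue | assumption)+

lemma lie_module_gl1: "lie_module gl1 U gl1_act"
proof (rule lie_module_image [OF lie_module_quot lie_algebra_gl1 _ _ linear_onto_id])
  have iso: "linear_iso (quot md m2d) gl1 quot_residue"
    and br: "bracket_hom (quot md m2d) gl1 quot_residue"
    using quot_residue_iso by (simp_all add: lie_iso_def bracket_hom_def)
  show "bracket_hom (quot md m2d) gl1 quot_residue" by (rule br)
  have "quot_residue (m2d +>\<^bsub>md\<^esub> vfield (tm * 0)) = 0"
    by (simp only: quot_residue_coset ev_zero)
  moreover have "m2d +>\<^bsub>md\<^esub> vfield (tm * 0) = \<zero>\<^bsub>quot md m2d\<^esub>"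
  proof -
    have "vfield (tm * 0) \<in> m2d" unfolding m2d_eq by (metis imageI mult_zero_right rangeI)
    then show ?thesis by (simp only: md_quot.quot_simps md_quot.coset_zero)
  qed
  ultimately show "linear_onto (quot md m2d) gl1 quot_residue"
    using iso by (simp add: linear_onto_def linear_iso_def bij_betw_def)
qed simp

lemma irreducible_gl1: "irreducible_lie_module gl1 U gl1_act"
  unfolding irreducible_lie_module_def
proof (intro conjI allI impI)
  show "lie_module gl1 U gl1_act" by (rule lie_module_gl1)
  show "carrier U \<noteq> {\<zero>\<^bsub>U\<^esub>}"
    using line_inj [of 1 0] by (auto simp: U_simps)
  fix N assume "lie_submodule gl1 U gl1_act N"
  then have N: "subspace_of N U" by (simp add: lie_submodule_def)
  interpret U: Module.module complex_field U by (rule module_U)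
  have sub: "N \<subseteq> carrier U" using U.submoduleE(1) [OF N] .
  have zero: "\<zero>\<^bsub>U\<^esub> \<in> N"
    using subgroup.one_closed [OF submodule.axioms(1) [OF N]] by simp
  show "N = {\<zero>\<^bsub>U\<^esub>} \<or> N = carrier U"
  proof (cases "N = {\<zero>\<^bsub>U\<^esub>}")
    case False
    then obtain x where x: "x \<in> N" "x \<noteq> \<zero>\<^bsub>U\<^esub>" using zero by blast
    then obtain z where z: "x = line z" "z \<noteq> 0" using sub U_cases by (metis U_simps(2) subsetD)
    have "line w \<in> N" for w
      using U.submoduleE(4) [OF N, of "w / z" x] x z by (simp add: U_simps)
    then show ?thesis using sub by (auto simp: U_simps)
  qed simp
qed

section \<open>The tensor product with the Laurent polynomials\<close>

abbreviation "A \<equiv> space_of (fscale :: complex \<Rightarrow> laurent \<Rightarrow> laurent)"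
abbreviation "UA \<equiv> tensor U A"
abbreviation "FS \<equiv> free_space (carrier U \<times> carrier A)"

abbreviation "e x a \<equiv> Poly_Mapping.single (x, a) 1"

lemma e_in_FS [simp]: "x \<in> carrier U \<Longrightarrow> e x a \<in> carrier FS"
  by simp

lemma FS_closed [simp]:
  "f \<in> carrier FS \<Longrightarrow> g \<in> carrier FS \<Longrightarrow> f + g \<in> carrier FS"
  "f \<in> carrier FS \<Longrightarrow> g \<in> carrier FS \<Longrightarrow> f - g \<in> carrier FS"
  "f \<in> carrier FS \<Longrightarrow> fscale c f \<in> carrier FS"
proof -
  show 1: "f \<in> carrier FS \<Longrightarrow> g \<in> carrier FS \<Longrightarrow> f + g \<in> carrier FS"
    and 2: "f \<in> carrier FS \<Longrightarrow> fscale c f \<in> carrier FS" for c f g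
    using module_closed [OF module_free_space [of "carrier U \<times> carrier A"]]
    by (simp_all only: free_space_simps(3,4))
  show "f \<in> carrier FS \<Longrightarrow> g \<in> carrier FS \<Longrightarrow> f - g \<in> carrier FS"
    using keys_diff [of f g] by auto
qed

lemma tensor_relations_carrier: "tensor_relations U A \<subseteq> carrier FS"
  using module_closed [OF module_U] unfolding tensor_relations_def Let_def
  by (auto simp del: free_space_simps(1) space_of_simps(1) intro!: FS_closed e_in_FS)

sublocale UA: subspace_quotient FS "tensor_kernel U A"
  unfolding tensor_kernel_def
  by (intro subspace_quotient.intro module_free_space lspan_subspace_of tensor_relations_carrier)

lemma module_UA: "Module.module complex_field UA"
  unfolding tensor_def by (rule UA.quot_module)

lemma tensor_relations_kernel: "tensor_relations U A \<subseteq> tensor_kernel U A"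
  unfolding tensor_kernel_def lspan_def by (rule hull_subset)

lemma UA_simps:
  "f \<in> carrier FS \<Longrightarrow> g \<in> carrier FS \<Longrightarrow>
    UA.q f \<oplus>\<^bsub>UA\<^esub> UA.q g = UA.q (f + g)"
  "f \<in> carrier FS \<Longrightarrow> c \<odot>\<^bsub>UA\<^esub> UA.q f = UA.q (fscale c f)"
  "carrier UA = UA.q ` carrier FS"
  unfolding tensor_def by (subst UA.quot_simps; simp only: free_space_simps(3,4))+

lemma UA_coset_eqI:
  assumes "f - g \<in> tensor_relations U A" "g \<in> carrier FS"
  shows "UA.q f = UA.q g"
  using UA.coset_add_left [OF subsetD [OF tensor_relations_kernel assms(1)] assms(2)] by simp

lemma pure_tensor_linear:
  assumes x: "x \<in> carrier U"
  shows "pure_tensor U A x (a + b) = pure_tensor U A x a \<oplus>\<^bsub>UA\<^esub> pure_tensor U A x b"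
    and "pure_tensor U A x (fscale c a) = c \<odot>\<^bsub>UA\<^esub> pure_tensor U A x a"
    and "pure_tensor U A (c \<odot>\<^bsub>U\<^esub> x) a = c \<odot>\<^bsub>UA\<^esub> pure_tensor U A x a"
proof -
  note e = e_in_FS [OF x]
  have "e x (a + b) - (e x a + e x b) \<in> tensor_relations U A"
    unfolding tensor_relations_def Let_def diff_diff_add [symmetric] using x by auto
  from UA_coset_eqI [OF this] e
  show "pure_tensor U A x (a + b) = pure_tensor U A x a \<oplus>\<^bsub>UA\<^esub> pure_tensor U A x b"
    unfolding pure_tensor_def by (simp only: UA_simps FS_closed)
  have "e x (fscale c a) - fscale c (e x a) \<in> tensor_relations U A"
    unfolding tensor_relations_def Let_def using x by auto
  from UA_coset_eqI [OF this] e
  show "pure_tensor U A x (fscale c a) = c \<odot>\<^bsub>UA\<^esub> pure_tensor U A x a"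
    unfolding pure_tensor_def by (simp only: UA_simps FS_closed)
  have "e (c \<odot>\<^bsub>U\<^esub> x) a - fscale c (e x a) \<in> tensor_relations U A"
    unfolding tensor_relations_def Let_def using x by auto
  from UA_coset_eqI [OF this] e
  show "pure_tensor U A (c \<odot>\<^bsub>U\<^esub> x) a = c \<odot>\<^bsub>UA\<^esub> pure_tensor U A x a"
    unfolding pure_tensor_def by (simp only: UA_simps FS_closed)
qed

text \<open>Contraction with the coordinate on the line \<open>U\<close>; it vanishes on the tensor relations and
  thus detects that \<open>line 1 \<otimes> a\<close> determines \<open>a\<close>.\<close>

definition contract :: "('v set \<times> laurent \<Rightarrow>\<^sub>0 complex) \<Rightarrow> laurent"
  where "contract f =
    (\<Sum>k\<in>Poly_Mapping.keys f. fscale (Poly_Mapping.lookup f k * inv_into UNIV line (fst k)) (snd k))"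

lemma contract_single: "contract (Poly_Mapping.single (x, a) c) = fscale (c * inv_into UNIV line x) a"
  by (simp add: contract_def fscale_simps(6))

lemma contract_add: "contract (f + g) = contract f + contract g"
  unfolding contract_def by (rule setsum_keys_plus_distrib) (simp_all add: fscale_simps ring_distribs)

lemma contract_diff: "contract (f - g) = contract f - contract g"
  using contract_add [of "f - g" g] by simp

lemma contract_fscale: "contract (fscale c f) = fscale c (contract f)"
proof (induction f rule: laurent_induct)
  case (single k d)
  show ?case by (cases k) (simp add: contract_single fscale_single fscale_simps mult.assoc)
qed (simp add: fscale_add contract_add)

lemma inv_line [simp]: "inv_into UNIV line (line z) = z"
  by (rule inv_f_f) (simp add: inj_def line_inj)

lemma contract_relation: "f \<in> tensor_relations U A \<Longrightarrow> contract f = 0"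
  unfolding tensor_relations_def Let_def
  by (auto elim!: U_cases simp: U_simps(3,4) contract_diff contract_fscale contract_single fscale_simps fscale_add mult.commute)

text \<open>The tensor kernel is the least subspace containing the relations, and the zeros of
  \<open>contract\<close> form such a subspace.\<close>

lemma contract_kernel: "f \<in> tensor_kernel U A \<Longrightarrow> contract f = 0"
proof -
  have "subspace_of {f \<in> carrier FS. contract f = 0} FS"
  proof (rule subspace_ofI [OF UA.M])
    show "\<zero>\<^bsub>FS\<^esub> \<in> {f \<in> carrier FS. contract f = 0}"
      using contract_diff [of 0 0] by simp
  qed (use FS_closed in \<open>auto simp: contract_add contract_fscale fscale_simps
      simp del: free_space_simps(1) space_of_simps(1)\<close>)
  then have "tensor_kernel U A \<subseteq> {f \<in> carrier FS. contract f = 0}"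
    unfolding tensor_kernel_def lspan_def
    using tensor_relations_carrier contract_relation by (intro hull_minimal) auto
  then show "f \<in> tensor_kernel U A \<Longrightarrow> contract f = 0" by blast
qed

definition tensor_map :: "'v \<Rightarrow> ('v set \<times> laurent \<Rightarrow>\<^sub>0 complex) set"
  where "tensor_map v = pure_tensor U A (line 1) (inv_into UNIV (\<lambda>a. mu a v0) v)"

lemma tensor_map_mu: "tensor_map (mu a v0) = pure_tensor U A (line 1) a"
  using inv_f_f [of "\<lambda>a. mu a v0" a] by (simp add: tensor_map_def inj_def mu_inj)

lemma line_carrier: "line z \<in> carrier U"
  by (simp add: U_simps)

lemma tensor_map_linear:
  "tensor_map (v + w) = tensor_map v \<oplus>\<^bsub>UA\<^esub> tensor_map w"
  "tensor_map (c *s v) = c \<odot>\<^bsub>UA\<^esub> tensor_map v"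
proof -
  obtain a b where "v = mu a v0" "w = mu b v0" by (metis v_cases)
  then show "tensor_map (v + w) = tensor_map v \<oplus>\<^bsub>UA\<^esub> tensor_map w"
    "tensor_map (c *s v) = c \<odot>\<^bsub>UA\<^esub> tensor_map v"
    using pure_tensor_linear(1,2) [OF line_carrier]
    by (simp_all only: tensor_map_mu flip: mu_linear(3,4))
qed

text \<open>The scalar z moves to the second factor; hence every pure tensor lies in the range of
  \<open>tensor_map\<close>.\<close>

lemma pure_tensor_line: "pure_tensor U A (line z) a = tensor_map (mu (fscale z a) v0)"
proof -
  have "line z = z \<odot>\<^bsub>U\<^esub> line 1" by (simp add: U_simps)
  then show ?thesis
    using pure_tensor_linear(2,3) [OF line_carrier [of 1]] by (simp only: tensor_map_mu)
qed

lemma bij_tensor_map: "bij_betw tensor_map UNIV (carrier UA)"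
proof (rule bij_betwI')
  fix v w
  obtain a b where vw: "v = mu a v0" "w = mu b v0" by (metis v_cases)
  have "a = b" if eq: "UA.q (e (line 1) a) = UA.q (e (line 1) b)"
  proof -
    obtain n where n: "n \<in> tensor_kernel U A" "e (line 1) a = n + e (line 1) b"
      using UA.coset_eqD [OF eq e_in_FS [OF line_carrier]] by auto
    then have "contract (e (line 1) a) = contract (e (line 1) b)"
      by (simp add: contract_add contract_kernel)
    then show ?thesis by (simp add: contract_single fscale_simps)
  qed
  then show "(tensor_map v = tensor_map w) = (v = w)"
    unfolding vw tensor_map_mu mu_inj pure_tensor_def by blast
next
  fix v
  show "tensor_map v \<in> carrier UA"
    unfolding tensor_map_def pure_tensor_def UA_simps by (intro imageI e_in_FS line_carrier)
next
  have "f \<in> carrier FS \<Longrightarrow> \<exists>v. UA.q f = tensor_map v" for f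
  proof (induction f rule: update_induct)
    case const
    have "e (line 1) (0 :: laurent) - fscale 0 (e (line 1) (0 :: laurent)) \<in> tensor_relations U A"
    proof -
      have "fscale 0 (0 :: laurent) = 0" by (simp add: fscale_simps)
      then show ?thesis
        unfolding tensor_relations_def Let_def using line_carrier [of 1]
        by (auto intro!: exI [of _ 0] exI [of _ "line 1"])
    qed
    moreover have "fscale 0 (e (line 1) (0 :: laurent)) = 0"
      by (rule poly_mapping_eqI) simp
    ultimately have "e (line 1) (0 :: laurent) - 0 \<in> tensor_relations U A" by (simp only:)
    then have "UA.q (e (line 1) (0 :: laurent)) = UA.q 0" by (rule UA_coset_eqI) simp
    then show ?case by (metis pure_tensor_def tensor_map_mu)
  next
    case (update f k c)
    obtain x a where k: "k = (x, a)" by (cases k)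
    have upd: "Poly_Mapping.update k c f = f + fscale c (e x a)"
      using update(1) by (intro poly_mapping_eqI)
        (auto simp: k lookup_update lookup_add lookup_single when_def in_keys_iff)
    have "Poly_Mapping.keys (Poly_Mapping.update k c f) = insert k (Poly_Mapping.keys f)"
      using update(2) by (simp add: keys_update)
    then have f: "f \<in> carrier FS" and x: "x \<in> carrier U" using update(4) by (auto simp: k)
    obtain z where z: "x = line z" using x by (rule U_cases)
    obtain v where v: "UA.q f = tensor_map v" using update(3) [OF f] by blast
    have "UA.q (Poly_Mapping.update k c f) = UA.q f \<oplus>\<^bsub>UA\<^esub> c \<odot>\<^bsub>UA\<^esub> pure_tensor U A x a"
      unfolding upd pure_tensor_def using f x by (simp only: UA_simps e_in_FS FS_closed)
    then show ?case
      unfolding v z pure_tensor_line tensor_map_linear [symmetric] by blast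
  qed
  then show "\<exists>v\<in>UNIV. y = tensor_map v" if "y \<in> carrier UA" for y
    using that unfolding UA_simps by blast
qed

text \<open>Transport from V, which makes \<open>tensor_map\<close> equivariant by construction; the
  explicit formulas are then checked in \<open>tensor_act_pure\<close>.\<close>

definition tensor_act :: "ader \<Rightarrow> ('v set \<times> laurent \<Rightarrow>\<^sub>0 complex) set \<Rightarrow> ('v set \<times> laurent \<Rightarrow>\<^sub>0 complex) set"
  where "tensor_act x y = tensor_map (\<rho> x (inv_into UNIV tensor_map y))"

lemma tensor_act_map: "tensor_act x (tensor_map v) = tensor_map (\<rho> x v)"
  using bij_tensor_map by (simp add: tensor_act_def bij_betw_def inv_f_f)

lemma tensor_iso: "linear_iso V UA tensor_map"
  using bij_tensor_map by (simp add: linear_iso_def tensor_map_linear)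

lemma lie_module_UA: "lie_module ADer UA tensor_act"
proof (rule lie_module_image [OF rep lie_algebra_ADer linear_onto_id bracket_hom_id])
  interpret UAm: Module.module complex_field UA by (rule module_UA)
  have "tensor_map 0 \<in> carrier UA"
    using bij_tensor_map by (auto dest: bij_betwE)
  then have "tensor_map 0 = \<zero>\<^bsub>UA\<^esub>"
    using tensor_map_linear(2) [of 0 0] UAm.smult_l_null [of "tensor_map 0"] by simp
  then show "linear_onto V UA tensor_map"
    using bij_tensor_map by (simp add: linear_onto_def tensor_map_linear bij_betw_def)
qed (rule tensor_act_map)

lemma tensor_act_pure:
  assumes x: "x \<in> carrier U"
  shows "tensor_act (dd r) (pure_tensor U A x (T s)) =
      (of_int s + \<alpha>) \<odot>\<^bsub>UA\<^esub> pure_tensor U A x (T (r + s))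
      \<oplus>\<^bsub>UA\<^esub> of_int r \<odot>\<^bsub>UA\<^esub> pure_tensor U A (gl1_act 1 x) (T (r + s))"
    and "tensor_act (tt r) (pure_tensor U A x (T s)) = pure_tensor U A x (T (r + s))"
proof -
  obtain z where z: "x = line z" using x by (rule U_cases)
  have "dv (T r) (mu (fscale z (T s)) v0) =
      (of_int s + \<alpha>) *s mu (fscale z (T (r + s))) v0 + of_int r *s mu (fscale (l * z) (T (r + s))) v0"
  proof -
    \<comment> \<open>The factor s + \<alpha> comes from d_0 on t^s \<open>v0\<close> and the factor
      r l from the derivative of t^r; l z is the coordinate of 1 acting on
      \<open>line z\<close>.\<close>
    have eq: "T r * (euler (fscale z (T s)) + fscale \<alpha> (fscale z (T s))) + fscale l (euler (T r) * fscale z (T s))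
        = fscale (of_int s + \<alpha>) (fscale z (T (r + s))) + fscale (of_int r) (fscale (l * z) (T (r + s)))"
      by (simp add: fscale_single euler_single mult_single algebra_simps flip: single_add)
    show ?thesis unfolding dv_mu_v0 eq by (simp only: mu_linear)
  qed
  then show "tensor_act (dd r) (pure_tensor U A x (T s)) =
      (of_int s + \<alpha>) \<odot>\<^bsub>UA\<^esub> pure_tensor U A x (T (r + s))
      \<oplus>\<^bsub>UA\<^esub> of_int r \<odot>\<^bsub>UA\<^esub> pure_tensor U A (gl1_act 1 x) (T (r + s))"
    by (simp only: z gl1_act_line mult_1 pure_tensor_line tensor_act_map dd_def dv_def tensor_map_linear)
  have "\<rho> (tt r) (mu (fscale z (T s)) v0) = mu (fscale z (T (r + s))) v0"
    by (simp add: tt_def flip: mu_def mu_mult fscale_T_mult del: mu_linear)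
  then show "tensor_act (tt r) (pure_tensor U A x (T s)) = pure_tensor U A x (T (r + s))"
    by (simp only: z pure_tensor_line tensor_act_map)
qed

lemma tensor_module_iso: "lie_module_iso ADer V \<rho> UA tensor_act tensor_map"
  using tensor_iso by (simp add: lie_module_iso_def tensor_act_map)

lemma m2d_act_zero:
  assumes "x \<in> m2d" "y \<in> carrier U"
  shows "Vbar_action V \<rho> \<alpha> x y = \<zero>\<^bsub>U\<^esub>"
proof -
  obtain f z where x: "x = vfield (tm * (tm * f))" and y: "y = line z"
    using assms U_cases unfolding m2d_eq mult.assoc [of tm tm] by blast
  show ?thesis unfolding x y act_line U_simps by simp
qed

end

section \<open>From weight spaces to the rank one model\<close>

theorem proposition4p2:
  fixes scale :: "complex \<Rightarrow> 'v::ab_group_add \<Rightarrow> 'v"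
    and \<rho> :: "ader \<Rightarrow> 'v \<Rightarrow> 'v"
    and \<alpha> :: complex
  assumes "vector_space scale"
    and "irreducible_lie_module ADer (space_of scale) \<rho>"
    and "weight_module (space_of scale) \<rho> Hsub"
    and "\<forall>\<mu>. fin_dim (space_of scale) (weight_space (space_of scale) \<rho> Hsub \<mu>)"
    and "\<forall>r s v. \<rho> (tt r) (\<rho> (tt s) v) = \<rho> (tt (r + s)) v"
    and "\<forall>v. \<rho> (tt 0) v = v"
    and "d0_space (space_of scale) \<rho> \<alpha> \<noteq> {0}"
  shows
    "let V = space_of scale;
         U = Vbar V \<rho> \<alpha>;
         act = Vbar_action V \<rho> \<alpha>;
         A = space_of fscale;
         UA = tensor U A
     in
       lie_module md U act \<and>
       (\<forall>x\<in>m2d. \<forall>u\<in>carrier U. act x u = \<zero>\<^bsub>U\<^esub>) \<and>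
       lie_ideal md m2d \<and>
       (\<exists>\<phi> \<kappa> \<tau> \<sigma> h.
          lie_iso (quot md m2d) gl1 \<phi> \<and>
          (\<forall>f. \<phi> (m2d +>\<^bsub>md\<^esub> vfield ((T 1 - 1) * f)) = laurent_eval f 1) \<and>
          lie_module (quot md m2d) U \<kappa> \<and>
          (\<forall>x\<in>carrier md. \<forall>u\<in>carrier U. \<kappa> (m2d +>\<^bsub>md\<^esub> x) u = act x u) \<and>
          (\<forall>C\<in>carrier (quot md m2d). \<forall>u\<in>carrier U. \<tau> (\<phi> C) u = \<kappa> C u) \<and>
          irreducible_lie_module gl1 U \<tau> \<and>
          lie_module ADer UA \<sigma> \<and>
          (\<forall>r s. \<forall>u\<in>carrier U.
             \<sigma> (dd r) (pure_tensor U A u (T s)) =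
               (of_int s + \<alpha>) \<odot>\<^bsub>UA\<^esub> pure_tensor U A u (T (r + s))
               \<oplus>\<^bsub>UA\<^esub> of_int r \<odot>\<^bsub>UA\<^esub> pure_tensor U A (\<tau> 1 u) (T (r + s)) \<and>
             \<sigma> (tt r) (pure_tensor U A u (T s)) = pure_tensor U A u (T (r + s))) \<and>
          lie_module_iso ADer V \<rho> UA \<sigma> h)"
proof -
  interpret complex_vector_space scale
    using assms(1) by (rule complex_vector_space.intro)
  have rep: "lie_module ADer (space_of scale) \<rho>"
    using assms(2) by (simp add: irreducible_lie_module_def)
  interpret ader_module scale \<rho>
    using rep assms(5,6) by unfold_locales auto
  have T0: "dd 0 = vfield 1" by (simp add: dd_def)
  define E where "E = d0_space (space_of scale) \<rho> \<alpha>"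
  have E: "E = {v. dv 1 v = scale \<alpha> v}"
    by (simp add: E_def d0_space_def T0 dv_def)
  \<comment> \<open>The weight with value 1 at t^0 and \<alpha> at d_0, given by the linear formula
    f + D to f(1) + \<alpha> D(t)(1) on the whole algebra.\<close>
  define \<chi> :: "ader \<Rightarrow> complex" where "\<chi> h = ev (fst h) + \<alpha> * ev (snd h (T 1))" for h
  have \<chi>: "\<chi> (tt 0) = 1" "\<chi> (dd 0) = \<alpha>"
    by (simp_all add: \<chi>_def tt_def dd_def vfield_def euler_single)
  have H: "tt 0 \<in> Hsub" "dd 0 \<in> Hsub"
    by (simp_all add: Hsub_def lspan_def hull_inc)
  \<comment> \<open>Carries finite dimensionality from weight spaces of H to the eigenspace of d_0;
    the two agree because t^0 acts as the identity.\<close>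
  have "weight_space (space_of scale) \<rho> Hsub \<chi> = E"
  proof
    show "weight_space (space_of scale) \<rho> Hsub \<chi> \<subseteq> E"
      using H \<chi> by (auto simp: weight_space_def E T0 dv_def)
    show "E \<subseteq> weight_space (space_of scale) \<rho> Hsub \<chi>"
    proof
      fix v assume v: "v \<in> E"
      \<comment> \<open>The elements that act on \<open>v\<close> by the scalar \<chi> form a
        subspace; containing both generators of H, it contains H.\<close>
      have "subspace_of {h \<in> carrier ADer. \<rho> h v = scale (\<chi> h) v} ADer"
      proof (rule subspace_ofI [OF module_ADer])
        show "\<zero>\<^bsub>ADer\<^esub> \<in> {h \<in> carrier ADer. \<rho> h v = scale (\<chi> h) v}"
          using dv_zero(2) [of v] by (simp add: zero_ADer vfield_in_ADer dv_def \<chi>_def vfield_def)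
        show "x \<oplus>\<^bsub>ADer\<^esub> y \<in> {h \<in> carrier ADer. \<rho> h v = scale (\<chi> h) v}"
          if "x \<in> {h \<in> carrier ADer. \<rho> h v = scale (\<chi> h) v}" "y \<in> {h \<in> carrier ADer. \<rho> h v = scale (\<chi> h) v}" for x y
        proof -
          have "\<chi> (x \<oplus>\<^bsub>ADer\<^esub> y) = \<chi> x + \<chi> y"
            by (cases x; cases y) (simp add: \<chi>_def algebra_simps)
          then show ?thesis
            using that module_closed(1) [OF module_ADer] by (simp add: rho_add_left scale_left_distrib)
        qed
        show "c \<odot>\<^bsub>ADer\<^esub> x \<in> {h \<in> carrier ADer. \<rho> h v = scale (\<chi> h) v}"
          if "x \<in> {h \<in> carrier ADer. \<rho> h v = scale (\<chi> h) v}" for c x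
        proof -
          have "\<chi> (c \<odot>\<^bsub>ADer\<^esub> x) = c * \<chi> x"
            by (cases x) (simp add: \<chi>_def algebra_simps)
          then show ?thesis
            using that module_closed(2) [OF module_ADer] by (simp add: rho_scale_left)
        qed
      qed auto
      moreover have "tt 0 \<in> carrier ADer" "dd 0 \<in> carrier ADer"
        by (simp_all add: tt_def dd_def vfield_in_ADer)
      then have "{tt 0, dd 0} \<subseteq> {h \<in> carrier ADer. \<rho> h v = scale (\<chi> h) v}"
        using v unit \<chi> by (simp add: E T0 dv_def)
      ultimately have "Hsub \<subseteq> {h \<in> carrier ADer. \<rho> h v = scale (\<chi> h) v}"
        unfolding Hsub_def lspan_def by (intro hull_minimal)
      then show "v \<in> weight_space (space_of scale) \<rho> Hsub \<chi>"
        by (auto simp: weight_space_def)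
    qed
  qed
  then obtain B where B: "finite B" "E = span B"
    using assms(4) by (metis fin_dim_def lspan_space_of)
  interpret irreducible_ader_module scale \<rho> \<alpha> B
    using assms(2,7) B E by unfold_locales (auto simp: E_def)
  obtain v0 l where v0: "dv 1 v0 = scale \<alpha> v0" "bij (\<lambda>a. mu a v0)"
    "\<And>f v. dv f v = mu f (dv 1 v) + scale l (mu (euler f) v)" "span B = range (\<lambda>c. scale c v0)"
    using rank_one by metis
  interpret R: rank_one_module scale \<rho> \<alpha> l v0
  proof unfold_locales
    show "d0_space (space_of scale) \<rho> \<alpha> = range (\<lambda>c. scale c v0)"
      using v0(4) B by (simp only: E_def)
  qed (fact v0)+
  show ?thesis
    unfolding Let_def
  proof (intro conjI exI [of _ quot_residue] exI [of _ "\<lambda>C. R.gl1_act (quot_residue C)"]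
      exI [of _ R.gl1_act] exI [of _ R.tensor_act] exI [of _ R.tensor_map])
    show "\<forall>f. quot_residue (m2d +>\<^bsub>md\<^esub> vfield ((T 1 - 1) * f)) = laurent_eval f 1"
      by (intro allI quot_residue_coset)
    show "lie_module md R.U (Vbar_action (space_of scale) \<rho> \<alpha>)" by (rule R.lie_module_U)
    show "lie_ideal md m2d" by (rule lie_ideal_m2d)
    show "lie_iso (quot md m2d) gl1 quot_residue" by (rule quot_residue_iso)
    show "lie_module (quot md m2d) R.U (\<lambda>C. R.gl1_act (quot_residue C))" by (rule R.lie_module_quot)
    show "irreducible_lie_module gl1 R.U R.gl1_act" by (rule R.irreducible_gl1)
    show "lie_module ADer R.UA R.tensor_act" by (rule R.lie_module_UA)
    show "lie_module_iso ADer (space_of scale) \<rho> R.UA R.tensor_act R.tensor_map"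
      by (rule R.tensor_module_iso)
  qed (intro ballI allI conjI refl R.m2d_act_zero R.gl1_act_quot_residue R.tensor_act_pure; assumption)+
qed

end
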